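(* Let $x\in B_4$ and $N_{\sf d}(x)=\delta^pd_1\cdots d_r$. Assume that for all $i=1,\ldots,r-1$ the pair $(d_i,d_{i+1})$ is not in the following list: $$\left\{\begin{array}{c}(a_{1,2}a_{3,4},\,a_{2,4}),\ (a_{1,2}a_{3,4},\,a_{3,4}a_{2,3}),\ (a_{1,2}a_{3,4},\,a_{1,2}a_{1,4}),\\ (a_{2,3}a_{1,4},\,a_{1,3}),\ (a_{2,3}a_{1,4},\,a_{1,3}a_{2,3}),\ (a_{2,3}a_{1,4},\,a_{1,3}a_{1,4})\end{array}\right\}.$$ Then: (i) $\sup_{\sf d}(x)=M(\rho_4(x))$; (ii) one can compute the dual normal form of $x$ from the matrix $\rho_4(x)$ (that is, there is an algorithm which, given the matrix $\rho_4(x)$ of a braid $x\in B_4$ whose dual normal form $N_{\sf d}(x)=\delta^pd_1\cdots d_r$ has no pair of consecutive factors $(d_i,d_{i+1})$, $1\le i\le r-1$, equal to one of the six pairs $(a_{1,2}a_{3,4},\,a_{2,4})$, $(a_{1,2}a_{3,4},\,a_{3,4}a_{2,3})$, $(a_{1,2}a_{3,4},\,a_{1,2}a_{1,4})$, $(a_{2,3}a_{1,4},\,a_{1,3})$, $(a_{2,3}a_{1,4},\,a_{1,3}a_{2,3})$, $(a_{2,3}a_{1,4},\,a_{1,3}a_{1,4})$, outputs $N_{\sf d}(x)$). In particular, if $x\in B_4$ is non-trivial and none of the factors $d_i$ of its dual left normal form equals $a_{1,2}a_{3,4}$ or $a_{2,3}a_{1,4}$, then $\rho_4(x)\neq 1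$.
   Context: $B_4$ is the 4-strand braid group with Artin generators $\sigma_1,\sigma_2,\sigma_3$. The reduced Burau representation $\rho_4:B_4\to GL(3,\mathbb Z[q^{\pm1}])$ is the homomorphism ($\rho_4(xy)=\rho_4(x)\rho_4(y)$) given by $$\rho_4(\sigma_1)=\begin{pmatrix}-q&0&0\\1&1&0\\0&0&1\end{pmatrix},\quad \rho_4(\sigma_2)=\begin{pmatrix}1&q&0\\0&-q&0\\0&1&1\end{pmatrix},\quad \rho_4(\sigma_3)=\begin{pmatrix}1&0&0\\0&1&q\\0&0&-q\end{pmatrix}.$$ For a non-zero Laurent polynomial $\Lambda$ in $q$, $M(\Lambda)$ is the maximal degree of $q$ in $\Lambda$; $M(0)=-\infty$; for a matrix, $M(\Lambda)=\max_{i,j}M(\Lambda_{ij})$. Dual Garside structure: for $1\le i<j\le4$ put $a_{i,j}=a_{j,i}=(\sigma_{j-2}\cdots\sigma_i)^{-1}\sigma_{j-1}(\sigma_{j-2}\cdots\sigma_i)$, and $\delta=\sigma_3\sigma_2\sigma_1$. $B_4^{+*}$ is the monoid generated by the $a_{i,j}$, and $x\preccurlyeq_{\sf d}y$ iff $x^{-1}y\in B_4^{+*}$ (a lattice order). Dual simple elements are the $d$ with $1\preccurlyeq_{\sf d}d\preccurlyeq_{\sf d}\delta$. A pair $(d,d')$ of dual simple elements is left-weighted if $\delta\wedge_{\sf d}(dd')=d$, with $\wedge_{\sf d}$ the meet for $\preccurlyeq_{\sf d}$. Every $x\in B_4$ has a unique dual (left) normal form $N_{\sf d}(x)=\delta^pd_1\cdots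 d_r$ with $p\in\mathbb Z$, $d_i$ dual simple, $d_1\ne\delta$, $d_r\ne1$ and all $(d_i,d_{i+1})$ left-weighted; $\sup_{\sf d}(x)=p+r$. *)

theory Defs
  imports
    "HOL-Analysis.Analysis"
    "HOL-Library.Poly_Mapping"
    "HOL-Library.Extended"
    "HOL-Library.Nat_Bijection"
begin

section \<open>The braid group on four strands\<close>

datatype artin = S1 | S2 | S3

text \<open>Words in the Artin generators and their inverses; the letter \<open>(s, True)\<close> stands for \<open>s\<close>
  and \<open>(s, False)\<close> for its formal inverse.\<close>

type_synonym artin_word = "(artin \<times> bool) list"

inductive braid_eq :: "artin_word \<Rightarrow> artin_word \<Rightarrow> bool" where
  refl: "braid_eq u u"
| sym: "braid_eq u v \<Longrightarrow> braid_eq v u"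
| trans: "braid_eq u v \<Longrightarrow> braid_eq v w \<Longrightarrow> braid_eq u w"
| append: "braid_eq u u' \<Longrightarrow> braid_eq v v' \<Longrightarrow> braid_eq (u @ v) (u' @ v')"
| cancel: "braid_eq [(s, b), (s, \<not> b)] []"
| braid12: "braid_eq [(S1, True), (S2, True), (S1, True)] [(S2, True), (S1, True), (S2, True)]"
| braid23: "braid_eq [(S2, True), (S3, True), (S2, True)] [(S3, True), (S2, True), (S3, True)]"
| comm13: "braid_eq [(S1, True), (S3, True)] [(S3, True), (S1, True)]"

quotient_type braid4 = artin_word / braid_eq
  by (intro equivpI reflpI sympI transpI)
    (rule braid_eq.refl, erule braid_eq.sym, erule (1) braid_eq.trans)

definition inverse_word :: "artin_word \<Rightarrow> artin_word" where
  "inverse_word w = rev (map (\<lambda>(s, b). (s, \<not> b)) w)"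

lemma inverse_word_Nil [simp]: "inverse_word [] = []"
  by (simp add: inverse_word_def)

lemma inverse_word_append [simp]: "inverse_word (u @ v) = inverse_word v @ inverse_word u"
  by (simp add: inverse_word_def)

lemma inverse_word_inverse_word [simp]: "inverse_word (inverse_word w) = w"
  by (induction w) (auto simp: inverse_word_def)

lemma inverse_word_left: "braid_eq (inverse_word w @ w) []"
proof (induction w)
  case (Cons a w)
  obtain s b where a: "a = (s, b)" by (cases a)
  have "braid_eq ([(s, \<not> b), (s, b)] @ w) ([] @ w)"
    using braid_eq.append[OF braid_eq.cancel[of s "\<not> b"] braid_eq.refl[of w]] by simp
  then have "braid_eq (inverse_word w @ ([(s, \<not> b), (s, b)] @ w)) (inverse_word w @ ([] @ w))"
    by (rule braid_eq.append[OF braid_eq.refl])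
  with Cons.IH show ?case
    by (simp add: a inverse_word_def) (rule braid_eq.trans)
qed (simp add: braid_eq.refl)

lemma inverse_word_cong:
  assumes "braid_eq u v"
  shows "braid_eq (inverse_word u) (inverse_word v)"
proof -
  have 1: "braid_eq (inverse_word u @ (v @ inverse_word v)) (inverse_word u @ [])"
    using inverse_word_left[of "inverse_word v"] by (intro braid_eq.append[OF braid_eq.refl]) simp
  have "braid_eq (inverse_word u @ v) (inverse_word u @ u)"
    by (rule braid_eq.append[OF braid_eq.refl braid_eq.sym[OF assms]])
  then have "braid_eq (inverse_word u @ v) []"
    by (rule braid_eq.trans[OF _ inverse_word_left])
  then have "braid_eq ((inverse_word u @ v) @ inverse_word v) ([] @ inverse_word v)"
    by (rule braid_eq.append[OF _ braid_eq.refl])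
  then have 2: "braid_eq (inverse_word u @ (v @ inverse_word v)) (inverse_word v)"
    by simp
  show ?thesis
    using braid_eq.trans[OF braid_eq.sym[OF 1] 2] by simp
qed

instantiation braid4 :: "{monoid_mult, inverse}"
begin

lift_definition one_braid4 :: braid4 is "[]" .

lift_definition times_braid4 :: "braid4 \<Rightarrow> braid4 \<Rightarrow> braid4" is "(@)"
  by (rule braid_eq.append)

lift_definition inverse_braid4 :: "braid4 \<Rightarrow> braid4" is inverse_word
  by (rule inverse_word_cong)

definition divide_braid4 :: "braid4 \<Rightarrow> braid4 \<Rightarrow> braid4" where
  "divide_braid4 x y = x * inverse y"

instance
  by intro_classes (transfer; simp add: braid_eq.refl)+

end

lemma braid4_left_inverse: "inverse x * x = (1 :: braid4)"
  by transfer (rule inverse_word_left)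

interpretation braid4: group "(*) :: braid4 \<Rightarrow> braid4 \<Rightarrow> braid4" 1 inverse
  by unfold_locales (simp_all add: braid4_left_inverse)

lift_definition artin_gen :: "artin \<Rightarrow> braid4" is "\<lambda>s. [(s, True)]" .

definition braid_sigma :: "nat \<Rightarrow> braid4" where
  "braid_sigma i = (if i = 1 then artin_gen S1 else if i = 2 then artin_gen S2 else artin_gen S3)"

lemma sigma_simps [simp]:
  "braid_sigma 1 = artin_gen S1" "braid_sigma (Suc 0) = artin_gen S1"
  "braid_sigma 2 = artin_gen S2" "braid_sigma 3 = artin_gen S3"
  by (simp_all add: braid_sigma_def)

lemma braid4_relations:
  "braid_sigma 1 * braid_sigma 2 * braid_sigma 1 = braid_sigma 2 * braid_sigma 1 * braid_sigma 2"
  "braid_sigma 2 * braid_sigma 3 * braid_sigma 2 = braid_sigma 3 * braid_sigma 2 * braid_sigma 3"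
  "braid_sigma 1 * braid_sigma 3 = braid_sigma 3 * braid_sigma 1"
  unfolding sigma_simps
  by (transfer; simp add: braid_eq.braid12 braid_eq.braid23 braid_eq.comm13)+


section \<open>The reduced Burau representation\<close>

text \<open>The integral group ring of the integers, i.e. the Laurent polynomials in \<open>q\<close> over \<open>\<int>\<close>:
  the exponent \<open>n\<close> is mapped to the coefficient of \<open>q\<^sup>n\<close>.\<close>

type_synonym laurent = "int \<Rightarrow>\<^sub>0 int"

definition qvar :: laurent where
  "qvar = Poly_Mapping.single 1 1"

definition qinv :: laurent where
  "qinv = Poly_Mapping.single (-1) 1"

lemma qvar_qinv [simp]: "qvar * qinv = 1" "qinv * qvar = 1"
  by (simp_all add: qvar_def qinv_def Poly_Mapping.mult_single)

fun burau_letter :: "artin \<times> bool \<Rightarrow> laurent^3^3" where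
  "burau_letter (S1, True) = vector [vector [- qvar, 0, 0], vector [1, 1, 0], vector [0, 0, 1]]"
| "burau_letter (S2, True) = vector [vector [1, qvar, 0], vector [0, - qvar, 0], vector [0, 1, 1]]"
| "burau_letter (S3, True) = vector [vector [1, 0, 0], vector [0, 1, qvar], vector [0, 0, - qvar]]"
| "burau_letter (S1, False) = vector [vector [- qinv, 0, 0], vector [qinv, 1, 0], vector [0, 0, 1]]"
| "burau_letter (S2, False) = vector [vector [1, 1, 0], vector [0, - qinv, 0], vector [0, qinv, 1]]"
| "burau_letter (S3, False) = vector [vector [1, 0, 0], vector [0, 1, 1], vector [0, 0, - qinv]]"

fun burau_word :: "artin_word \<Rightarrow> laurent^3^3" where
  "burau_word [] = mat 1"
| "burau_word (a # w) = burau_letter a ** burau_word w"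

lemma burau_word_append: "burau_word (u @ v) = burau_word u ** burau_word v"
  by (induction u) (simp_all add: matrix_mul_assoc)

lemma burau_letter_cancel: "burau_letter (s, b) ** burau_letter (s, \<not> b) = mat 1"
  by (cases s; cases b)
    (simp_all add: vec_eq_iff matrix_matrix_mult_def mat_def forall_3 sum_3)

lemma burau_word_relations:
  "burau_word [(S1, True), (S2, True), (S1, True)] = burau_word [(S2, True), (S1, True), (S2, True)]"
  "burau_word [(S2, True), (S3, True), (S2, True)] = burau_word [(S3, True), (S2, True), (S3, True)]"
  "burau_word [(S1, True), (S3, True)] = burau_word [(S3, True), (S1, True)]"
  by (simp_all add: vec_eq_iff matrix_matrix_mult_def forall_3 sum_3 algebra_simps)

lemma burau_word_cong: "braid_eq u v \<Longrightarrow> burau_word u = burau_word v"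
proof (induction rule: braid_eq.induct)
  case (append u u' v v')
  then show ?case by (simp only: burau_word_append)
next
  case (cancel s b)
  show ?case by (simp add: burau_letter_cancel)
qed (simp_all only: burau_word_relations)

lift_definition burau :: "braid4 \<Rightarrow> laurent^3^3" is burau_word
  by (rule burau_word_cong)

lemma burau_mult: "burau (x * y) = burau x ** burau y"
  by transfer (rule burau_word_append)

lemma burau_artin_gen: "burau (artin_gen s) = burau_letter (s, True)"
  by transfer simp

lemma burau_sigma:
  "burau (braid_sigma 1) = vector [vector [- qvar, 0, 0], vector [1, 1, 0], vector [0, 0, 1]]"
  "burau (braid_sigma 2) = vector [vector [1, qvar, 0], vector [0, - qvar, 0], vector [0, 1, 1]]"
  "burau (braid_sigma 3) = vector [vector [1, 0, 0], vector [0, 1, qvar], vector [0, 0, - qvar]]"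
  by (simp_all only: sigma_simps burau_artin_gen burau_letter.simps)

definition max_deg :: "laurent \<Rightarrow> int extended" where
  "max_deg f = (if f = 0 then Minf else Fin (Max (Poly_Mapping.keys f)))"

definition mat_max_deg :: "laurent^3^3 \<Rightarrow> int extended" where
  "mat_max_deg A = Max {max_deg (A $ i $ j) | i j. True}"


section \<open>The dual Garside structure\<close>

definition band :: "nat \<Rightarrow> nat \<Rightarrow> braid4" where
  "band i j =
    (let k = min i j; l = max i j; w = prod_list (map braid_sigma (rev [k..<l - 1]))
     in inverse w * braid_sigma (l - 1) * w)"

definition delta :: braid4 where
  "delta = braid_sigma 3 * braid_sigma 2 * braid_sigma 1"

inductive_set dual_monoid :: "braid4 set" where
  one: "1 \<in> dual_monoid"
| gen: "1 \<le> i \<Longrightarrow> i < j \<Longrightarrow> j \<le> 4 \<Longrightarrow> band i j \<in> dual_monoid"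
| mult: "x \<in> dual_monoid \<Longrightarrow> y \<in> dual_monoid \<Longrightarrow> x * y \<in> dual_monoid"

definition dual_le :: "braid4 \<Rightarrow> braid4 \<Rightarrow> bool" (infix \<open>\<preceq>\<^sub>d\<close> 50) where
  "x \<preceq>\<^sub>d y \<longleftrightarrow> inverse x * y \<in> dual_monoid"

definition dual_simple :: "braid4 \<Rightarrow> bool" where
  "dual_simple d \<longleftrightarrow> 1 \<preceq>\<^sub>d d \<and> d \<preceq>\<^sub>d delta"

definition is_dual_meet :: "braid4 \<Rightarrow> braid4 \<Rightarrow> braid4 \<Rightarrow> bool" where
  "is_dual_meet x y m \<longleftrightarrow>
    m \<preceq>\<^sub>d x \<and> m \<preceq>\<^sub>d y \<and> (\<forall>w. w \<preceq>\<^sub>d x \<and> w \<preceq>\<^sub>d y \<longrightarrow> w \<preceq>\<^sub>d m)"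

definition left_weighted :: "braid4 \<Rightarrow> braid4 \<Rightarrow> bool" where
  "left_weighted d d' \<longleftrightarrow> is_dual_meet delta (d * d') d"

text \<open>\<open>dual_normal_form x p ds\<close> says that \<open>N(x) = \<delta>\<^sup>p d\<^sub>1 \<dots> d\<^sub>r\<close> where
  \<open>ds = [d\<^sub>1, \<dots>, d\<^sub>r]\<close>.\<close>

definition dual_normal_form :: "braid4 \<Rightarrow> int \<Rightarrow> braid4 list \<Rightarrow> bool" where
  "dual_normal_form x p ds \<longleftrightarrow>
    x = delta powi p * prod_list ds \<and>
    (\<forall>d\<in>set ds. dual_simple d) \<and>
    (ds \<noteq> [] \<longrightarrow> hd ds \<noteq> delta \<and> last ds \<noteq> 1) \<and>
    (\<forall>i. Suc i < length ds \<longrightarrow> left_weighted (ds ! i) (ds ! Suc i))"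

text \<open>The supremum of the braid with normal form \<open>\<delta>\<^sup>p d\<^sub>1 \<dots> d\<^sub>r\<close>.\<close>

definition dual_sup :: "int \<Rightarrow> braid4 list \<Rightarrow> int" where
  "dual_sup p ds = p + int (length ds)"

definition forbidden_pairs :: "(braid4 \<times> braid4) set" where
  "forbidden_pairs =
    {(band 1 2 * band 3 4, band 2 4),
     (band 1 2 * band 3 4, band 3 4 * band 2 3),
     (band 1 2 * band 3 4, band 1 2 * band 1 4),
     (band 2 3 * band 1 4, band 1 3),
     (band 2 3 * band 1 4, band 1 3 * band 2 3),
     (band 2 3 * band 1 4, band 1 3 * band 1 4)}"

definition avoids_forbidden :: "braid4 list \<Rightarrow> bool" where
  "avoids_forbidden ds \<longleftrightarrow>
    (\<forall>i. Suc i < length ds \<longrightarrow> (ds ! i, ds ! Suc i) \<notin> forbidden_pairs)"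


section \<open>Algorithms\<close>

text \<open>Algorithms are Kleene's partial recursive functions, with the arity left implicit in the
  length of the argument list. \<open>computes f xs y\<close> says that \<open>f\<close> halts on \<open>xs\<close> with output \<open>y\<close>.
  In \<open>PrimRec\<close> and \<open>Mu\<close> the recursion resp. search variable is the first argument.\<close>

datatype recfun =
    Zero
  | Succ
  | Proj nat
  | Comp recfun "recfun list"
  | PrimRec recfun recfun
  | Mu recfun

inductive computes :: "recfun \<Rightarrow> nat list \<Rightarrow> nat \<Rightarrow> bool" where
  Zero: "computes Zero xs 0"
| Succ: "computes Succ [n] (Suc n)"
| Proj: "i < length xs \<Longrightarrow> computes (Proj i) xs (xs ! i)"
| Comp: "length ys = length gs \<Longrightarrow> (\<forall>i < length gs. computes (gs ! i) xs (ys ! i)) \<Longrightarrow>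
    computes f ys z \<Longrightarrow> computes (Comp f gs) xs z"
| PrimRec_0: "computes f xs z \<Longrightarrow> computes (PrimRec f g) (0 # xs) z"
| PrimRec_Suc: "computes (PrimRec f g) (n # xs) r \<Longrightarrow> computes g (n # r # xs) z \<Longrightarrow>
    computes (PrimRec f g) (Suc n # xs) z"
| Mu: "computes f (n # xs) 0 \<Longrightarrow> (\<forall>m < n. \<exists>k > 0. computes f (m # xs) k) \<Longrightarrow>
    computes (Mu f) xs n"

inductive_cases computes_ZeroE: "computes Zero xs z"
inductive_cases computes_SuccE: "computes Succ xs z"
inductive_cases computes_ProjE: "computes (Proj i) xs z"
inductive_cases computes_CompE: "computes (Comp f gs) xs z"
inductive_cases computes_PrimRec_0E: "computes (PrimRec f g) (0 # xs) z"
inductive_cases computes_PrimRec_SucE: "computes (PrimRec f g) (Suc n # xs) z"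
inductive_cases computes_MuE: "computes (Mu f) xs z"

lemma computes_deterministic: "computes f xs y \<Longrightarrow> computes f xs z \<Longrightarrow> y = z"
proof (induction arbitrary: z rule: computes.induct)
  case (Zero xs)
  then show ?case by (rule computes_ZeroE) simp
next
  case (Succ n)
  then show ?case by (rule computes_SuccE) simp
next
  case (Proj i xs)
  from Proj.prems show ?case by (rule computes_ProjE) simp
next
  case (Comp ys gs xs f z')
  from Comp.prems show ?case
  proof (rule computes_CompE)
    fix ys'
    assume ys': "length ys' = length gs" "\<forall>i < length gs. computes (gs ! i) xs (ys' ! i)"
      and z: "computes f ys' z"
    have "ys ! i = ys' ! i" if "i < length ys" for i
      using that Comp.hyps(1) Comp.IH(1) ys'(2) by metis
    then have "ys = ys'"
      using Comp.hyps(1) ys'(1) by (intro nth_equalityI) simp_all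
    with z show ?thesis using Comp.IH(2) by blast
  qed
next
  case (PrimRec_0 f xs z' g)
  from PrimRec_0.prems show ?case by (rule computes_PrimRec_0E) (rule PrimRec_0.IH)
next
  case (PrimRec_Suc f g n xs r z')
  from PrimRec_Suc.prems show ?case
  proof (rule computes_PrimRec_SucE)
    fix r'
    assume "computes (PrimRec f g) (n # xs) r'" and z: "computes g (n # r' # xs) z"
    then have "r = r'" using PrimRec_Suc.IH(1) by blast
    with z show ?thesis using PrimRec_Suc.IH(2) by blast
  qed
next
  case (Mu f n xs)
  from Mu.prems show ?case
  proof (rule computes_MuE)
    assume z: "computes f (z # xs) 0" "\<forall>m < z. \<exists>k > 0. computes f (m # xs) k"
    show ?thesis
    proof (cases n z rule: linorder_cases)
      case less
      then obtain k where "k > 0" "computes f (n # xs) k" using z(2) by blast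
      then show ?thesis using Mu.IH(1)[of k] by simp
    next
      case greater
      then obtain k where "k > 0" "\<And>y. computes f (z # xs) y \<Longrightarrow> k = y"
        using Mu.IH(2) by blast
      then show ?thesis using z(1) by fastforce
    qed
  qed
qed

text \<open>A Laurent polynomial is presented by the list of its non-zero terms (exponent, coefficient)
  in order of increasing exponent, and a matrix by its nine entries, row by row.\<close>

definition encode_laurent :: "laurent \<Rightarrow> nat" where
  "encode_laurent f = list_encode
    (map (\<lambda>n. prod_encode (int_encode n, int_encode (Poly_Mapping.lookup f n)))
      (sorted_list_of_set (Poly_Mapping.keys f)))"

definition encode_matrix :: "laurent^3^3 \<Rightarrow> nat" where
  "encode_matrix A = list_encode (map encode_laurent
    [A $ 1 $ 1, A $ 1 $ 2, A $ 1 $ 3,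
     A $ 2 $ 1, A $ 2 $ 2, A $ 2 $ 3,
     A $ 3 $ 1, A $ 3 $ 2, A $ 3 $ 3])"

text \<open>Each factor of a normal form is written out as a word in the dual generators, the
  pair \<open>(i, j)\<close> with \<open>1 \<le> i < j \<le> 4\<close> standing for \<open>band i j\<close>.\<close>

definition is_band_word :: "(nat \<times> nat) list \<Rightarrow> bool" where
  "is_band_word w \<longleftrightarrow> (\<forall>(i, j)\<in>set w. 1 \<le> i \<and> i < j \<and> j \<le> 4)"

definition eval_band_word :: "(nat \<times> nat) list \<Rightarrow> braid4" where
  "eval_band_word w = prod_list (map (\<lambda>(i, j). band i j) w)"

definition encode_normal_form :: "int \<Rightarrow> (nat \<times> nat) list list \<Rightarrow> nat" where
  "encode_normal_form p ws =
    prod_encode (int_encode p, list_encode (map (\<lambda>w. list_encode (map prod_encode w)) ws))"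

definition represents_normal_form :: "nat \<Rightarrow> int \<Rightarrow> braid4 list \<Rightarrow> bool" where
  "represents_normal_form c p ds \<longleftrightarrow>
    (\<exists>ws. (\<forall>w\<in>set ws. is_band_word w) \<and> map eval_band_word ws = ds \<and>
      c = encode_normal_form p ws)"

end

theory Submission
  imports Defs
begin

text \<open>The Burau matrix of a dual simple element \<open>d\<close> has the form \<open>A + q B\<close> with integer matrices
  \<open>A\<close> and \<open>B\<close>, and that of \<open>\<delta>\<close> is \<open>q\<close> times an invertible integer matrix. Hence the coefficient
  of \<open>q\<^sup>p\<^sup>+\<^sup>r\<close> in the Burau matrix of \<open>\<delta>\<^sup>p d\<^sub>1 \<dots> d\<^sub>r\<close> is, up to an invertible factor on the left, the
  product of the matrices \<open>B\<close> of the \<open>d\<^sub>i\<close>. If no forbidden pair occurs, the kernel of this product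
  depends (almost) only on \<open>d\<^sub>r\<close>: it is a proper subspace from which \<open>d\<^sub>r\<close> can be read off, and it is
  trivial only for \<open>r = 0\<close>. So the degree is \<open>p + r\<close>, and peeling off the last factor shows that the
  matrix determines the normal form. The normal form is then found by an unbounded search, in which
  matrices of Laurent polynomials are compared by substituting a large integer for \<open>q\<close>.\<close>

section \<open>Dual simple elements\<close>

text \<open>The kernel of a product is the preimage, under its last matrix, of the kernel of the
  rest. The argument works because for the permitted pairs this preimage stays in a finite family,
  fixed by the last factor and one bit. A forbidden pair can leave the family: after
  \<open>D13\<close>, \<open>D12_34\<close> the kernel is x = z, and appending \<open>D234\<close>
  turns it into 2 y + z = 0, which is none of the kernels in the table. Negative powers of delta
  have matrices that are not of the form A + q B. Since the matrix of delta^4 is q^4 times the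
  identity, delta^(-1) may be replaced by delta^3 up to a power of q, so that only products of
  simple elements have to be studied. Uniqueness is proved for all sequences allowed by a finite
  table of pairs, a class into which every normal form without forbidden pairs falls. The search
  therefore checks candidates against this table and never has to decide left-weightedness or
  equality of braids: a candidate with the right matrix must be the normal form.\<close>

lemma braid4_cancel [simp]:
  "(x :: braid4) * (inverse x * y) = y" "inverse x * (x * y) = y"
  by (simp_all flip: mult.assoc)

lemma inverse_braid4_mult: "inverse (x * y :: braid4) = inverse y * inverse x"
  by (rule braid4.inverse_distrib_swap)

section \<open>Relations between the band generators\<close>

lemma band_artin:
  "band 1 2 = artin_gen S1" "band 2 3 = artin_gen S2" "band 3 4 = artin_gen S3"
  "band 1 3 = inverse (artin_gen S1) * (artin_gen S2 * artin_gen S1)"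
  "band 2 4 = inverse (artin_gen S2) * (artin_gen S3 * artin_gen S2)"
  "band 1 4 = inverse (artin_gen S1) * (inverse (artin_gen S2) *
    (artin_gen S3 * (artin_gen S2 * artin_gen S1)))"
  by (simp_all add: band_def Let_def mult.assoc upt_rec inverse_braid4_mult braid_sigma_def)

text \<open>These are the length-two relations of the dual presentation. Each is oriented towards
  one chosen word per element, so that they serve as rewrite rules to a common form.\<close>

lemma dual_relations:
  "band 2 3 * band 1 2 = band 1 2 * band 1 3" "band 1 3 * band 2 3 = band 1 2 * band 1 3"
  "band 2 4 * band 1 2 = band 1 2 * band 1 4" "band 1 4 * band 2 4 = band 1 2 * band 1 4"
  "band 3 4 * band 2 3 = band 2 3 * band 2 4" "band 2 4 * band 3 4 = band 2 3 * band 2 4"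
  "band 1 3 * band 1 4 = band 3 4 * band 1 3" "band 1 4 * band 3 4 = band 3 4 * band 1 3"
  "band 3 4 * band 1 2 = band 1 2 * band 3 4" "band 1 4 * band 2 3 = band 2 3 * band 1 4"
proof -
  define a b c where abc: "a = artin_gen S1" "b = artin_gen S2" "c = artin_gen S3"
  have bab: "b * (a * b) = a * (b * a)" and cbc: "c * (b * c) = b * (c * b)" and ca: "c * a = a * c"
    using braid4_relations by (simp_all add: abc mult.assoc)
  have bab': "b * (a * (b * x)) = a * (b * (a * x))" and cbc': "c * (b * (c * x)) = b * (c * (b * x))"
    and ca': "c * (a * x) = a * (c * x)" for x
    using bab cbc ca by (metis mult.assoc)+
  \<comment> \<open>Conjugated forms of the relations: they let simplification move the inverse
    letters that occur in the words of \<open>band 1 3\<close>, \<open>band 2 4\<close> and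
    \<open>band 1 4\<close>.\<close>
  have Ac: "c * (inverse a * x) = inverse a * (c * x)" for x
    using ca'[of "inverse a * x"] by (metis braid4_cancel)
  have Ba: "inverse b * (a * x) = a * (b * (inverse a * (inverse b * x)))" for x
    using bab'[of "inverse a * (inverse b * x)"] by (metis braid4_cancel)
  have baB: "b * (a * (inverse b * x)) = inverse a * (b * (a * x))" for x
    using bab'[of "inverse b * x"] by (metis braid4_cancel)
  show "band 2 3 * band 1 2 = band 1 2 * band 1 3" "band 1 3 * band 2 3 = band 1 2 * band 1 3"
    "band 2 4 * band 1 2 = band 1 2 * band 1 4"
    "band 3 4 * band 2 3 = band 2 3 * band 2 4" "band 2 4 * band 3 4 = band 2 3 * band 2 4"
    "band 3 4 * band 1 2 = band 1 2 * band 3 4"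
    by (simp_all del: One_nat_def add: band_artin abc[symmetric] mult.assoc bab cbc ca)
  show "band 1 4 * band 3 4 = band 3 4 * band 1 3" "band 1 3 * band 1 4 = band 3 4 * band 1 3"
    by (simp_all del: One_nat_def add: band_artin abc[symmetric] mult.assoc ca[symmetric] cbc' Ac)
  have "inverse a * (inverse b * (a * (c * (b * a)))) = b * (inverse a * (inverse b * (c * (b * a))))"
    by (simp add: Ba)
  then show "band 1 4 * band 2 3 = band 2 3 * band 1 4"
    by (simp del: One_nat_def add: band_artin abc[symmetric] mult.assoc bab ca')
  have "c * (b * (a * (inverse b * (c * b)))) = b * (a * (inverse b * (c * (b * a))))"
    by (simp add: baB Ac cbc' ca' bab flip: ca')
  then have "inverse b * (c * (b * (a * (inverse b * (c * b))))) = a * (inverse b * (c * (b * a)))"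
    by simp
  then show "band 1 4 * band 2 4 = band 1 2 * band 1 4"
    by (simp del: One_nat_def add: band_artin abc[symmetric] mult.assoc)
qed

section \<open>The non-trivial dual simple elements and their divisors\<close>

datatype simple =
  D12 | D23 | D34 | D13 | D24 | D14 | D12_34 | D23_14 | D123 | D124 | D234 | D134 | Delta

text \<open>The dual simple elements correspond to the 14 non-crossing partitions of four points;
  the partition into singletons is the identity and is left out, as it is never a factor of a normal
  form. The words of length two are the right-hand sides of \<open>dual_relations\<close>.\<close>

fun simple_word :: "simple \<Rightarrow> (nat \<times> nat) list" where
  "simple_word D12 = [(1, 2)]"
| "simple_word D23 = [(2, 3)]"
| "simple_word D34 = [(3, 4)]"
| "simple_word D13 = [(1, 3)]"
| "simple_word D24 = [(2, 4)]"
| "simple_word D14 = [(1, 4)]"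
| "simple_word D12_34 = [(1, 2), (3, 4)]"
| "simple_word D23_14 = [(2, 3), (1, 4)]"
| "simple_word D123 = [(1, 2), (1, 3)]"
| "simple_word D124 = [(1, 2), (1, 4)]"
| "simple_word D234 = [(2, 3), (2, 4)]"
| "simple_word D134 = [(3, 4), (1, 3)]"
| "simple_word Delta = [(3, 4), (2, 3), (1, 2)]"

definition simple_braid :: "simple \<Rightarrow> braid4" where
  "simple_braid s = eval_band_word (simple_word s)"

text \<open>The bands \<open>b\<close> with \<open>b \<preceq>\<^sub>d s\<close>, and those with \<open>s b \<preceq>\<^sub>d \<delta>\<close>.\<close>

fun prefix_bands :: "simple \<Rightarrow> (nat \<times> nat) list" where
  "prefix_bands D12_34 = [(1, 2), (3, 4)]"
| "prefix_bands D23_14 = [(2, 3), (1, 4)]"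
| "prefix_bands D123 = [(1, 2), (2, 3), (1, 3)]"
| "prefix_bands D124 = [(1, 2), (2, 4), (1, 4)]"
| "prefix_bands D234 = [(2, 3), (3, 4), (2, 4)]"
| "prefix_bands D134 = [(3, 4), (1, 3), (1, 4)]"
| "prefix_bands Delta = [(1, 2), (2, 3), (3, 4), (1, 3), (2, 4), (1, 4)]"
| "prefix_bands s = simple_word s"

fun extending_bands :: "simple \<Rightarrow> (nat \<times> nat) list" where
  "extending_bands D12 = [(1, 3), (3, 4), (1, 4)]"
| "extending_bands D23 = [(2, 4), (1, 2), (1, 4)]"
| "extending_bands D34 = [(2, 3), (1, 2), (1, 3)]"
| "extending_bands D13 = [(2, 3), (1, 4)]"
| "extending_bands D24 = [(1, 2), (3, 4)]"
| "extending_bands D14 = [(2, 3), (2, 4), (3, 4)]"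
| "extending_bands D12_34 = [(1, 3)]"
| "extending_bands D23_14 = [(2, 4)]"
| "extending_bands D123 = [(1, 4)]"
| "extending_bands D124 = [(3, 4)]"
| "extending_bands D234 = [(1, 2)]"
| "extending_bands D134 = [(2, 3)]"
| "extending_bands Delta = []"

text \<open>The left-weighted pairs that are not forbidden.\<close>

fun successors :: "simple \<Rightarrow> simple list" where
  "successors D12 = [D12, D23, D24]"
| "successors D23 = [D23, D34, D13]"
| "successors D34 = [D34, D24, D14]"
| "successors D13 = [D12, D34, D13, D24, D12_34]"
| "successors D24 = [D23, D13, D24, D14, D23_14]"
| "successors D14 = [D12, D13, D14]"
| "successors D12_34 = [D12, D23, D34, D14, D12_34, D23_14]"
| "successors D23_14 = [D12, D23, D34, D14, D12_34, D23_14]"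
| "successors D123 = [D12, D23, D34, D13, D24, D12_34, D123, D234]"
| "successors D124 = [D12, D23, D13, D24, D14, D123, D124, D23_14]"
| "successors D234 = [D23, D34, D13, D24, D14, D234, D23_14, D134]"
| "successors D134 = [D12, D34, D13, D24, D14, D12_34, D124, D134]"
| "successors Delta = [D12, D23, D34, D13, D24, D14, D12_34, D23_14, D123, D124, D234, D134, Delta]"

lemma delta_bands: "delta = band 3 4 * (band 2 3 * band 1 2)"
  by (simp add: delta_def band_artin mult.assoc del: One_nat_def)

lemma simple_braid_Delta: "simple_braid Delta = delta"
  by (simp add: simple_braid_def eval_band_word_def delta_bands)

lemma dual_relations_left:
  "band 2 3 * (band 1 2 * x) = band 1 2 * (band 1 3 * x)" "band 1 3 * (band 2 3 * x) = band 1 2 * (band 1 3 * x)"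
  "band 2 4 * (band 1 2 * x) = band 1 2 * (band 1 4 * x)" "band 1 4 * (band 2 4 * x) = band 1 2 * (band 1 4 * x)"
  "band 3 4 * (band 2 3 * x) = band 2 3 * (band 2 4 * x)" "band 2 4 * (band 3 4 * x) = band 2 3 * (band 2 4 * x)"
  "band 1 3 * (band 1 4 * x) = band 3 4 * (band 1 3 * x)" "band 1 4 * (band 3 4 * x) = band 3 4 * (band 1 3 * x)"
  "band 3 4 * (band 1 2 * x) = band 1 2 * (band 3 4 * x)" "band 1 4 * (band 2 3 * x) = band 2 3 * (band 1 4 * x)"
  using dual_relations by (metis mult.assoc)+

lemma prefix_bands:
  assumes "(i, j) \<in> set (prefix_bands s)"
  shows "\<exists>c\<in>dual_monoid. simple_braid s = band i j * c"
proof -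
  have b: "band 1 2 \<in> dual_monoid" "band 2 3 \<in> dual_monoid" "band 3 4 \<in> dual_monoid"
    "band 1 3 \<in> dual_monoid" "band 2 4 \<in> dual_monoid" "band 1 4 \<in> dual_monoid"
    by (auto intro: dual_monoid.gen)
  \<comment> \<open>All complements that occur are listed in advance, so that in each case one of
    them only has to be selected and verified by rewriting.\<close>
  define C where "C = {1, band 1 2, band 2 3, band 3 4, band 1 3, band 2 4, band 1 4,
    band 3 4 * band 1 3, band 1 2 * band 3 4, band 3 4 * band 2 3, band 2 3 * band 1 2, band 1 4 * band 2 3,
    band 2 4 * band 1 2}"
  have "C \<subseteq> dual_monoid"
    unfolding C_def using b by (auto intro: dual_monoid.one dual_monoid.mult)
  moreover have "\<exists>c\<in>C. simple_braid s = band i j * c"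
    using assms unfolding C_def
    by (cases s)
      (auto simp: simple_braid_def eval_band_word_def dual_relations dual_relations_left
        simp del: One_nat_def)
  ultimately show ?thesis by blast
qed

lemma extending_bands:
  assumes "(i, j) \<in> set (extending_bands s)"
  shows "\<exists>c\<in>dual_monoid. simple_braid s * band i j * c = delta"
proof -
  define C where "C = {1, band 1 2, band 2 3, band 3 4, band 1 3, band 2 4, band 1 4}"
  have "C \<subseteq> dual_monoid"
    unfolding C_def by (auto intro: dual_monoid.one dual_monoid.gen)
  moreover have "\<exists>c\<in>C. simple_braid s * band i j * c = delta"
    using assms unfolding C_def
    by (cases s)
      (auto simp: simple_braid_def eval_band_word_def dual_relations dual_relations_left
        delta_bands mult.assoc simp del: One_nat_def)
  ultimately show ?thesis by blast
qed

section \<open>Exponent sum and strand permutation\<close>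

lift_definition exponent :: "braid4 \<Rightarrow> int" is
  "\<lambda>w. \<Sum>(s, b)\<leftarrow>w. if b then 1 else - 1"
  by (induct_tac rule: braid_eq.induct) auto

lemma exponent_mult: "exponent (x * y) = exponent x + exponent y"
  by transfer simp

lemma exponent_one [simp]: "exponent 1 = 0"
  by transfer simp

lemma exponent_inverse: "exponent (inverse x) = - exponent x"
  using exponent_mult[of "inverse x" x] by (simp add: braid4_left_inverse)

lemma exponent_artin_gen [simp]: "exponent (artin_gen s) = 1"
  by transfer simp

lemma exponent_delta: "exponent delta = 3"
  by (simp add: delta_def exponent_mult)

definition all_bands :: "(nat \<times> nat) list" where
  "all_bands = [(1, 2), (2, 3), (3, 4), (1, 3), (2, 4), (1, 4)]"

lemma band_cases: "1 \<le> i \<Longrightarrow> i < j \<Longrightarrow> j \<le> 4 \<Longrightarrow> (i, j) \<in> set all_bands"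
  by (auto simp: all_bands_def)

lemma exponent_band: "(i, j) \<in> set all_bands \<Longrightarrow> exponent (band i j) = 1"
  by (auto simp: all_bands_def band_artin exponent_mult exponent_inverse simp del: One_nat_def)

text \<open>Every band has exponent sum 1, so the exponent sum counts the bands in any word for an
  element of the monoid. This bounds the words that can divide \<open>delta\<close> and shows that
  no inverse of a band lies in the monoid.\<close>

lemma dual_monoid_word:
  assumes "x \<in> dual_monoid"
  shows "\<exists>w. set w \<subseteq> set all_bands \<and> x = eval_band_word w \<and> exponent x = int (length w)"
  using assms
proof induction
  case one
  show ?case by (intro exI[of _ "[]"]) (simp add: eval_band_word_def)
next
  case (gen i j)
  then show ?case
    using band_cases[OF gen] exponent_band[OF band_cases[OF gen]]
    by (intro exI[of _ "[(i, j)]"]) (simp add: eval_band_word_def)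
next
  case (mult x y)
  then obtain v w where "set v \<subseteq> set all_bands" "x = eval_band_word v" "exponent x = int (length v)"
    "set w \<subseteq> set all_bands" "y = eval_band_word w" "exponent y = int (length w)"
    by blast
  then show ?case
    by (intro exI[of _ "v @ w"]) (simp add: eval_band_word_def exponent_mult)
qed

lemma exponent_dual_monoid_nonneg: "x \<in> dual_monoid \<Longrightarrow> exponent x \<ge> 0"
  using dual_monoid_word by fastforce

fun artin_swap :: "artin \<Rightarrow> nat \<Rightarrow> nat" where
  "artin_swap S1 k = (if k = 1 then 2 else if k = 2 then 1 else k)"
| "artin_swap S2 k = (if k = 2 then 3 else if k = 3 then 2 else k)"
| "artin_swap S3 k = (if k = 3 then 4 else if k = 4 then 3 else k)"

lemma artin_swap_involution: "artin_swap s (artin_swap s k) = k"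
  by (cases s) auto

text \<open>The sign of a letter is ignored because a transposition is its own inverse.\<close>

lift_definition strand_perm :: "braid4 \<Rightarrow> nat \<Rightarrow> nat" is
  "\<lambda>w k. foldr (\<lambda>(s, b). artin_swap s) w k"
proof -
  fix v w :: artin_word
  assume "braid_eq v w"
  then have "\<forall>k. foldr (\<lambda>(s, b). artin_swap s) v k = foldr (\<lambda>(s, b). artin_swap s) w k"
    by induction (simp_all add: artin_swap_involution)
  then show "(\<lambda>k. foldr (\<lambda>(s, b). artin_swap s) v k) = (\<lambda>k. foldr (\<lambda>(s, b). artin_swap s) w k)"
    by blast
qed

lemma strand_perm_mult: "strand_perm (x * y) k = strand_perm x (strand_perm y k)"
  by transfer simp

lemma strand_perm_artin_gen:
  "strand_perm (artin_gen s) k = artin_swap s k"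
  "strand_perm (inverse (artin_gen s)) k = artin_swap s k"
  by (transfer; simp add: inverse_word_def)+

definition band_swap :: "nat \<times> nat \<Rightarrow> nat \<Rightarrow> nat" where
  "band_swap p k = (if k = fst p then snd p else if k = snd p then fst p else k)"

lemma strand_perm_band:
  "(i, j) \<in> set all_bands \<Longrightarrow> strand_perm (band i j) k = band_swap (i, j) k"
  by (auto simp: all_bands_def band_artin strand_perm_mult strand_perm_artin_gen band_swap_def
      simp del: One_nat_def)

text \<open>The permutation of \<open>delta\<close> is a 4-cycle, which has 4^2 = 16 factorizations
  into three transpositions. Each is determined by its first two factors, and these are the pairs in
  the list.\<close>

lemma strand_perm_delta_factorization:
  "\<forall>p\<in>set all_bands. \<forall>q\<in>set all_bands. \<forall>r\<in>set all_bands.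
    (\<forall>k\<in>set [1, 2, 3, 4]. band_swap p (band_swap q (band_swap r k)) =
      band_swap (3, 4) (band_swap (2, 3) (band_swap (1, 2) k))) \<longrightarrow>
    (p, q) \<in> set [((1, 2), (1, 3)), ((1, 2), (1, 4)), ((1, 2), (3, 4)), ((2, 3), (1, 2)),
      ((2, 3), (1, 4)), ((2, 3), (2, 4)), ((3, 4), (1, 2)), ((3, 4), (1, 3)), ((3, 4), (2, 3)),
      ((1, 3), (2, 3)), ((1, 3), (1, 4)), ((2, 4), (1, 2)), ((2, 4), (3, 4)), ((1, 4), (2, 3)),
      ((1, 4), (2, 4)), ((1, 4), (3, 4))]"
  unfolding all_bands_def band_swap_def by code_simp

lemma band_pairs:
  "band 1 2 * band 3 4 = simple_braid D12_34" "band 3 4 * band 1 2 = simple_braid D12_34"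
  "band 2 3 * band 1 4 = simple_braid D23_14" "band 1 4 * band 2 3 = simple_braid D23_14"
  "band 1 2 * band 1 3 = simple_braid D123" "band 2 3 * band 1 2 = simple_braid D123"
  "band 1 3 * band 2 3 = simple_braid D123"
  "band 1 2 * band 1 4 = simple_braid D124" "band 2 4 * band 1 2 = simple_braid D124"
  "band 1 4 * band 2 4 = simple_braid D124"
  "band 2 3 * band 2 4 = simple_braid D234" "band 3 4 * band 2 3 = simple_braid D234"
  "band 2 4 * band 3 4 = simple_braid D234"
  "band 3 4 * band 1 3 = simple_braid D134" "band 1 3 * band 1 4 = simple_braid D134"
  "band 1 4 * band 3 4 = simple_braid D134"
  by (simp_all add: simple_braid_def eval_band_word_def dual_relations del: One_nat_def)

lemma single_bands:
  "band 1 2 = simple_braid D12" "band 2 3 = simple_braid D23" "band 3 4 = simple_braid D34"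
  "band 1 3 = simple_braid D13" "band 2 4 = simple_braid D24" "band 1 4 = simple_braid D14"
  by (simp_all add: simple_braid_def eval_band_word_def)

text \<open>The exponent sums of \<open>d\<close> and of its complement in \<open>delta\<close> add
  up to 3, so \<open>d\<close> is a product of at most three bands. Only two bands need an argument:
  the permutation leaves 16 pairs, and \<open>band_pairs\<close> identifies the product of
  each.\<close>

lemma dual_simple_cases:
  assumes "dual_simple d"
  shows "d = 1 \<or> (\<exists>s. d = simple_braid s)"
proof -
  have d: "d \<in> dual_monoid" "inverse d * delta \<in> dual_monoid"
    using assms braid4_cancel(2)[of 1 d] by (simp_all add: dual_simple_def dual_le_def)
  obtain v where v: "set v \<subseteq> set all_bands" "d = eval_band_word v" "exponent d = int (length v)"
    using dual_monoid_word[OF d(1)] by blast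
  obtain w where w: "set w \<subseteq> set all_bands" "inverse d * delta = eval_band_word w"
    "exponent (inverse d * delta) = int (length w)"
    using dual_monoid_word[OF d(2)] by blast
  have len: "length v + length w = 3"
    using v(3) w(3) by (simp add: exponent_mult exponent_inverse exponent_delta)
  have delta: "delta = d * eval_band_word w"
    by (simp flip: w(2))
  consider "length v = 0" | "length v = 1" | "length v = 2" | "length v = 3" using len by linarith
  then show ?thesis
  proof cases
    case 1
    then show ?thesis using v(2) by (simp add: eval_band_word_def)
  next
    case 2
    then obtain i j where p: "v = [(i, j)]" "(i, j) \<in> set all_bands"
      using v(1) by (auto simp: length_Suc_conv)
    have "d = band i j" using v(2) p(1) by (simp add: eval_band_word_def)
    then have "\<exists>s. d = simple_braid s"
      using p(2) unfolding all_bands_def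
      by (simp only: list.set insert_iff empty_iff prod.inject)
        (elim disjE conjE; simp only: single_bands; blast)
    then show ?thesis by blast
  next
    case 3
    then obtain i j k l where p: "v = [(i, j), (k, l)]" "(i, j) \<in> set all_bands" "(k, l) \<in> set all_bands"
      using v(1) by (auto simp: length_Suc_conv numeral_2_eq_2)
    have "length w = 1" using 3 len by simp
    then obtain m n where r: "w = [(m, n)]" "(m, n) \<in> set all_bands"
      using w(1) by (auto simp: length_Suc_conv)
    have d: "d = band i j * band k l" using v(2) p(1) by (simp add: eval_band_word_def)
    have "delta = band i j * (band k l * band m n)"
      using delta r(1) by (simp add: d eval_band_word_def mult.assoc)
    then have "strand_perm (band i j * (band k l * band m n)) x =
        strand_perm (band 3 4 * (band 2 3 * band 1 2)) x" for x
      by (simp add: delta_bands)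
    then have "band_swap (i, j) (band_swap (k, l) (band_swap (m, n) x)) =
        band_swap (3, 4) (band_swap (2, 3) (band_swap (1, 2) x))" for x
      unfolding strand_perm_mult strand_perm_band[OF p(2)] strand_perm_band[OF p(3)]
        strand_perm_band[OF r(2)] by (simp add: strand_perm_band all_bands_def)
    then have "((i, j), (k, l)) \<in> set [((1, 2), (1, 3)), ((1, 2), (1, 4)), ((1, 2), (3, 4)),
      ((2, 3), (1, 2)), ((2, 3), (1, 4)), ((2, 3), (2, 4)), ((3, 4), (1, 2)), ((3, 4), (1, 3)),
      ((3, 4), (2, 3)), ((1, 3), (2, 3)), ((1, 3), (1, 4)), ((2, 4), (1, 2)), ((2, 4), (3, 4)),
      ((1, 4), (2, 3)), ((1, 4), (2, 4)), ((1, 4), (3, 4))]"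
      using strand_perm_delta_factorization p(2,3) r(2) by blast
    then have "\<exists>s. d = simple_braid s"
      unfolding d by (simp only: list.set insert_iff empty_iff prod.inject)
        (elim disjE conjE; simp only: band_pairs; blast)
    then show ?thesis by blast
  next
    case 4
    then have "d = delta" using delta len by (simp add: eval_band_word_def)
    then show ?thesis using simple_braid_Delta by metis
  qed
qed

section \<open>Left-weighted pairs and normal forms\<close>

lemma not_left_weighted:
  assumes "left_weighted d d'" "(i, j) \<in> set all_bands"
    and "d * band i j * c = delta" "c \<in> dual_monoid"
    and "d' = band i j * e" "e \<in> dual_monoid"
  shows False
proof -
  have 1: "inverse (d * band i j) * delta = c"
    by (simp flip: assms(3) add: inverse_braid4_mult mult.assoc)
  have 2: "inverse (d * band i j) * (d * d') = e"
    unfolding assms(5) by (simp add: inverse_braid4_mult mult.assoc)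
  \<comment> \<open>The band can be moved from \<open>d'\<close> to \<open>d\<close>: the enlarged
    element divides both \<open>delta\<close> and \<open>d * d'\<close>, hence their meet
    \<open>d\<close>, which has smaller exponent sum.\<close>
  have "d * band i j \<preceq>\<^sub>d delta" "d * band i j \<preceq>\<^sub>d d * d'" 
    unfolding dual_le_def 1 2 by (rule assms)+
  then have "d * band i j \<preceq>\<^sub>d d"
    using assms(1) unfolding left_weighted_def is_dual_meet_def by blast
  then have "inverse (band i j) \<in> dual_monoid"
    unfolding dual_le_def by (simp add: inverse_braid4_mult mult.assoc braid4_left_inverse)
  then have "exponent (inverse (band i j)) \<ge> 0"
    by (rule exponent_dual_monoid_nonneg)
  then show False
    using exponent_band[OF assms(2)] by (simp add: exponent_inverse)
qed

text \<open>For every pair that is neither in \<open>successors\<close> nor forbidden, some band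
  extends \<open>s\<close> inside \<open>delta\<close> and is a prefix of \<open>t\<close>. The
  forbidden pairs have no such band and must be excluded by hypothesis.\<close>

lemma left_weighted_simple:
  assumes "left_weighted (simple_braid s) (simple_braid t)"
    and "(simple_braid s, simple_braid t) \<notin> forbidden_pairs"
  shows "t \<in> set (successors s)"
proof (rule ccontr)
  assume t: "t \<notin> set (successors s)"
  have "\<not> (s = D12_34 \<and> t \<in> {D24, D234, D124} \<or> s = D23_14 \<and> t \<in> {D13, D123, D134})"
    using assms(2)
    unfolding forbidden_pairs_def band_pairs unfolding single_bands by blast
  then have "set (extending_bands s) \<inter> set (prefix_bands t) \<noteq> {}"
    using t by (cases s; cases t; simp)
  then obtain i j where ij: "(i, j) \<in> set (extending_bands s)" "(i, j) \<in> set (prefix_bands t)"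
    by auto
  then have "(i, j) \<in> set all_bands"
    by (cases s) (auto simp: all_bands_def)
  moreover obtain c where "c \<in> dual_monoid" "simple_braid s * band i j * c = delta"
    using extending_bands[OF ij(1)] by blast
  moreover obtain e where "e \<in> dual_monoid" "simple_braid t = band i j * e"
    using prefix_bands[OF ij(2)] by blast
  ultimately show False
    using not_left_weighted[OF assms(1)] by blast
qed

text \<open>Every band divides \<open>delta\<close>, so any band that begins the second factor could
  be moved into the trivial first one.\<close>

lemma left_weighted_1_simple: "\<not> left_weighted 1 (simple_braid s)"
proof
  assume s: "left_weighted 1 (simple_braid s)"
  obtain i j where ij: "(i, j) \<in> set (prefix_bands s)"
    by (cases s) auto
  then have "(i, j) \<in> set (prefix_bands Delta)"
    by (cases s) auto
  then obtain c where c: "c \<in> dual_monoid" "delta = band i j * c"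
    using prefix_bands[of i j Delta] unfolding simple_braid_Delta by blast
  obtain e where e: "e \<in> dual_monoid" "simple_braid s = band i j * e"
    using prefix_bands[OF ij] by blast
  have "(i, j) \<in> set all_bands"
    using ij by (cases s) (auto simp: all_bands_def)
  then show False
    using not_left_weighted[OF s _ _ c(1) e(2,1)] c(2) by simp
qed

abbreviation good_sequence :: "simple list \<Rightarrow> bool" where
  "good_sequence \<equiv> successively (\<lambda>s t. t \<in> set (successors s))"

lemma dual_normal_form_good_sequence:
  assumes "dual_normal_form x p ds" "avoids_forbidden ds"
  obtains ss where "ds = map simple_braid ss" "good_sequence ss" "Delta \<notin> set ss"
proof -
  have simple: "d = 1 \<or> (\<exists>s. d = simple_braid s)" if "d \<in> set ds" for d
    using assms(1) that dual_simple_cases by (auto simp: dual_normal_form_def)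
  have lw: "left_weighted (ds ! i) (ds ! Suc i)" if "Suc i < length ds" for i
    using assms(1) that by (auto simp: dual_normal_form_def)
  \<comment> \<open>A trivial factor forces all later ones to be trivial, contrary to the condition
    on the last factor.\<close>
  have one: "ds ! i = 1 \<Longrightarrow> ds ! (i + k) = 1" if "i + k < length ds" for i k
    using that
  proof (induction k)
    case (Suc k)
    then have "ds ! (i + k) = 1" by simp
    then have "left_weighted 1 (ds ! (i + Suc k))" using lw[of "i + k"] Suc.prems by simp
    then show ?case using left_weighted_1_simple simple[of "ds ! (i + Suc k)"] Suc.prems by auto
  qed simp
  have "1 \<notin> set ds"
  proof
    assume "1 \<in> set ds"
    then obtain i where i: "i < length ds" "ds ! i = 1" by (auto simp: in_set_conv_nth)
    then have "last ds = 1"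
      using one[of i "length ds - 1 - i"] by (simp add: last_conv_nth flip: length_greater_0_conv)
    then show False using assms(1) i(1) by (auto simp: dual_normal_form_def)
  qed
  then have "\<forall>d\<in>set ds. \<exists>s. d = simple_braid s" using simple by metis
  then obtain f where f: "\<forall>d\<in>set ds. d = simple_braid (f d)" by metis
  define ss where "ss = map f ds"
  have ds: "ds = map simple_braid ss" unfolding ss_def using f by (simp add: map_idI)
  have good: "good_sequence ss"
  proof (unfold successively_conv_nth, intro allI impI)
    fix i assume i: "Suc i < length ss"
    show "ss ! Suc i \<in> set (successors (ss ! i))"
      using lw[of i] assms(2) i by (intro left_weighted_simple) (auto simp: ds avoids_forbidden_def)
  qed
  \<comment> \<open>\<open>Delta\<close> is listed as a successor of \<open>Delta\<close> only, so
    an occurrence anywhere would propagate back to the head.\<close>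
  have "Delta \<notin> set ts" if "good_sequence ts" "ts \<noteq> [] \<Longrightarrow> hd ts \<noteq> Delta" for ts
    using that
  proof (induction ts)
    case (Cons t ts)
    have "ts \<noteq> [] \<Longrightarrow> hd ts \<noteq> Delta"
      using Cons.prems by (cases t; cases ts; auto)
    then show ?case using Cons by (cases ts) auto
  qed simp
  moreover have "ss \<noteq> [] \<Longrightarrow> hd ss \<noteq> Delta"
    using assms(1) by (auto simp: dual_normal_form_def ds hd_map simple_braid_Delta)
  ultimately show ?thesis using that ds good by blast
qed

section \<open>Burau matrices of the simple elements\<close>

definition lin :: "int \<Rightarrow> int \<Rightarrow> laurent" where
  "lin a b = Poly_Mapping.single 0 a + Poly_Mapping.single 1 b"

lemma lookup_times_single:
  "Poly_Mapping.lookup (f * Poly_Mapping.single m a) k = Poly_Mapping.lookup f (k - m) * a"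
  for f :: laurent
proof -
  have inner: "Sum_any (\<lambda>q. Poly_Mapping.lookup (Poly_Mapping.single m a) q when k = l + q) =
      (a when k = l + m)" for l
  proof -
    have "(\<lambda>q. Poly_Mapping.lookup (Poly_Mapping.single m a) q when k = l + q) =
        (\<lambda>q. (a when k = l + m) when q = m)"
      by (auto simp: lookup_single when_def)
    then show ?thesis by (simp only: Sum_any_when_equal)
  qed
  have "(\<lambda>l. Poly_Mapping.lookup f l * (a when k = l + m)) =
      (\<lambda>l. Poly_Mapping.lookup f l * a when l = k - m)"
    by (auto simp: when_def)
  then show ?thesis by (simp only: lookup_mult inner Sum_any_when_equal)
qed

fun const_part :: "simple \<Rightarrow> int^3^3" where
  "const_part D12 = vector [vector [0, 0, 0], vector [1, 1, 0], vector [0, 0, 1]]"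
| "const_part D23 = vector [vector [1, 0, 0], vector [0, 0, 0], vector [0, 1, 1]]"
| "const_part D34 = vector [vector [1, 0, 0], vector [0, 1, 0], vector [0, 0, 0]]"
| "const_part D13 = vector [vector [0, - 1, 0], vector [0, 1, 0], vector [1, 1, 1]]"
| "const_part D24 = vector [vector [1, 0, 0], vector [0, 0, - 1], vector [0, 0, 1]]"
| "const_part D14 = vector [vector [0, - 1, - 1], vector [0, 1, 0], vector [0, 0, 1]]"
| "const_part D12_34 = vector [vector [0, 0, 0], vector [1, 1, 0], vector [0, 0, 0]]"
| "const_part D123 = vector [vector [0, 0, 0], vector [0, 0, 0], vector [1, 1, 1]]"
| "const_part D124 = vector [vector [0, 0, 0], vector [0, 0, - 1], vector [0, 0, 1]]"
| "const_part D234 = vector [vector [1, 0, 0], vector [0, 0, 0], vector [0, 0, 0]]"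
| "const_part D23_14 = vector [vector [0, - 1, - 1], vector [0, 0, 0], vector [0, 1, 1]]"
| "const_part D134 = vector [vector [0, - 1, 0], vector [0, 1, 0], vector [0, 0, 0]]"
| "const_part Delta = vector [vector [0, 0, 0], vector [0, 0, 0], vector [0, 0, 0]]"

fun linear_part :: "simple \<Rightarrow> int^3^3" where
  "linear_part D12 = vector [vector [- 1, 0, 0], vector [0, 0, 0], vector [0, 0, 0]]"
| "linear_part D23 = vector [vector [0, 1, 0], vector [0, - 1, 0], vector [0, 0, 0]]"
| "linear_part D34 = vector [vector [0, 0, 0], vector [0, 0, 1], vector [0, 0, - 1]]"
| "linear_part D13 = vector [vector [0, 0, 0], vector [- 1, - 1, 0], vector [0, 0, 0]]"
| "linear_part D24 = vector [vector [0, 1, 1], vector [0, 0, 0], vector [0, - 1, - 1]]"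
| "linear_part D14 = vector [vector [0, 0, 0], vector [0, 0, 0], vector [- 1, - 1, - 1]]"
| "linear_part D12_34 = vector [vector [- 1, 0, 0], vector [0, 0, 1], vector [0, 0, - 1]]"
| "linear_part D123 = vector [vector [0, 1, 0], vector [- 1, - 1, 0], vector [0, 0, 0]]"
| "linear_part D124 = vector [vector [0, 1, 1], vector [0, 0, 0], vector [- 1, - 1, - 1]]"
| "linear_part D234 = vector [vector [0, 1, 0], vector [0, 0, 1], vector [0, - 1, - 1]]"
| "linear_part D23_14 = vector [vector [0, 1, 0], vector [0, - 1, 0], vector [- 1, - 1, - 1]]"
| "linear_part D134 = vector [vector [0, 0, 0], vector [0, 0, 1], vector [- 1, - 1, - 1]]"
| "linear_part Delta = vector [vector [0, 1, 0], vector [0, 0, 1], vector [- 1, - 1, - 1]]"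

lemma lookup_times_lin: "Poly_Mapping.lookup (f * lin a b) k =
    Poly_Mapping.lookup f k * a + Poly_Mapping.lookup f (k - 1) * b"
  by (simp add: lin_def distrib_left lookup_add lookup_times_single)

lemma burau_inverse_artin_gen: "burau (inverse (artin_gen s)) = burau_letter (s, False)"
  by transfer (simp add: inverse_word_def)

lemma burau_one: "burau 1 = mat 1"
  by transfer simp

lemma lin_simps:
  "lin 0 0 = 0" "lin 1 0 = 1" "lin (- 1) 0 = - 1" "lin 0 1 = qvar" "lin 0 (- 1) = - qvar"
  "lin 1 (- 1) = 1 - qvar" "lin (- 1) 1 = qvar - 1"
  by (simp_all add: lin_def qvar_def single_uminus)

lemma qvar_qinv_left: "qvar * (qinv * x) = x" "qinv * (qvar * x) = x"
  by (simp_all flip: mult.assoc)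

lemma burau_bands:
  "burau (band 1 2) = vector [vector [- qvar, 0, 0], vector [1, 1, 0], vector [0, 0, 1]]"
  "burau (band 2 3) = vector [vector [1, qvar, 0], vector [0, - qvar, 0], vector [0, 1, 1]]"
  "burau (band 3 4) = vector [vector [1, 0, 0], vector [0, 1, qvar], vector [0, 0, - qvar]]"
  "burau (band 1 3) = vector [vector [0, - 1, 0], vector [- qvar, 1 - qvar, 0], vector [1, 1, 1]]"
  "burau (band 2 4) = vector [vector [1, qvar, qvar], vector [0, 0, - 1], vector [0, - qvar, 1 - qvar]]"
  "burau (band 1 4) = vector [vector [0, - 1, - 1], vector [0, 1, 0], vector [- qvar, - qvar, 1 - qvar]]"
  by (simp_all add: band_artin burau_mult burau_artin_gen burau_inverse_artin_gen vec_eq_iff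
      matrix_matrix_mult_def forall_3 sum_3 algebra_simps qvar_qinv_left del: One_nat_def)

lemma burau_simple:
  "burau (simple_braid s) = (\<chi> i j. lin (const_part s $ i $ j) (linear_part s $ i $ j))"
  by (cases s)
    (simp_all add: simple_braid_def eval_band_word_def burau_mult burau_bands burau_one vec_eq_iff
      matrix_matrix_mult_def forall_3 sum_3 lin_simps algebra_simps del: One_nat_def)

section \<open>Kernels of leading coefficient matrices\<close>

text \<open>The bound is stated coefficient by coefficient, so that zero entries need no separate
  case as they do with \<open>max_deg\<close>.\<close>

definition deg_le :: "laurent^3^3 \<Rightarrow> int \<Rightarrow> bool" where
  "deg_le M n \<longleftrightarrow> (\<forall>i j k. n < k \<longrightarrow> Poly_Mapping.lookup (M $ i $ j) k = 0)"

definition coeff_matrix :: "laurent^3^3 \<Rightarrow> int \<Rightarrow> int^3^3" where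
  "coeff_matrix M n = (\<chi> i j. Poly_Mapping.lookup (M $ i $ j) n)"

definition shift_matrix :: "int \<Rightarrow> laurent^3^3 \<Rightarrow> laurent^3^3" where
  "shift_matrix m M = (\<chi> i j. M $ i $ j * Poly_Mapping.single m 1)"

lemma shift_matrix_mult:
  "shift_matrix m M ** N = shift_matrix m (M ** N)" "M ** shift_matrix m N = shift_matrix m (M ** N)"
  by (simp_all add: shift_matrix_def matrix_matrix_mult_def sum_distrib_right mult.assoc
      mult.commute[of "Poly_Mapping.single m 1"])

lemma shift_matrix_add: "shift_matrix m (shift_matrix n M) = shift_matrix (m + n) M"
  by (simp add: shift_matrix_def mult.assoc mult_single add.commute)

lemma shift_matrix_0 [simp]: "shift_matrix 0 M = M"
  by (simp add: shift_matrix_def vec_eq_iff)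

lemma deg_le_shift: "deg_le M n \<Longrightarrow> deg_le (shift_matrix m M) (n + m)"
  by (simp add: deg_le_def shift_matrix_def lookup_times_single)

lemma coeff_matrix_shift: "coeff_matrix (shift_matrix m M) n = coeff_matrix M (n - m)"
  by (simp add: coeff_matrix_def shift_matrix_def lookup_times_single)

lemma lookup_mult_simple:
  "Poly_Mapping.lookup ((M ** burau (simple_braid s)) $ i $ j) k =
    (\<Sum>l\<in>UNIV. Poly_Mapping.lookup (M $ i $ l) k * const_part s $ l $ j +
      Poly_Mapping.lookup (M $ i $ l) (k - 1) * linear_part s $ l $ j)"
  by (simp add: burau_simple matrix_matrix_mult_def lookup_sum lookup_times_lin)

lemma deg_le_mult_simple: "deg_le M n \<Longrightarrow> deg_le (M ** burau (simple_braid s)) (n + 1)"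
  unfolding deg_le_def lookup_mult_simple by simp

text \<open>In degree \<open>n + 1\<close> the constant part would meet a coefficient of
  \<open>M\<close> above its degree bound, so only the linear part contributes.\<close>

lemma coeff_matrix_mult_simple:
  "deg_le M n \<Longrightarrow> coeff_matrix (M ** burau (simple_braid s)) (n + 1) = coeff_matrix M n ** linear_part s"
  unfolding coeff_matrix_def lookup_mult_simple
  by (simp add: deg_le_def matrix_matrix_mult_def)

text \<open>The kernel of the leading matrix of a good sequence depends only on its last factor \<open>s\<close>,
  except for \<open>D12_34\<close> and \<open>D23_14\<close>, whose kernel is larger if they were first reached from \<open>D13\<close> or \<open>D24\<close>.\<close>

fun leading_kernel :: "simple \<Rightarrow> bool \<Rightarrow> int \<Rightarrow> int \<Rightarrow> int \<Rightarrow> bool" where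
  "leading_kernel D12 b x y z \<longleftrightarrow> x = 0"
| "leading_kernel D23 b x y z \<longleftrightarrow> y = 0"
| "leading_kernel D34 b x y z \<longleftrightarrow> z = 0"
| "leading_kernel D13 b x y z \<longleftrightarrow> x + y = 0"
| "leading_kernel D24 b x y z \<longleftrightarrow> y + z = 0"
| "leading_kernel D14 b x y z \<longleftrightarrow> x + y + z = 0"
| "leading_kernel D12_34 b x y z \<longleftrightarrow> (if b then x = z else x = 0 \<and> z = 0)"
| "leading_kernel D23_14 b x y z \<longleftrightarrow> (if b then x + 2 * y + z = 0 else y = 0 \<and> x + z = 0)"
| "leading_kernel D123 b x y z \<longleftrightarrow> x = 0 \<and> y = 0"
| "leading_kernel D124 b x y z \<longleftrightarrow> x = 0 \<and> y + z = 0"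
| "leading_kernel D234 b x y z \<longleftrightarrow> y = 0 \<and> z = 0"
| "leading_kernel D134 b x y z \<longleftrightarrow> x + y = 0 \<and> z = 0"
| "leading_kernel Delta b x y z \<longleftrightarrow> x = 0 \<and> y = 0 \<and> z = 0"

text \<open>This is the flag for the factor that follows \<open>s\<close>: it is raised by
  \<open>D13\<close> and \<open>D24\<close> and survives only along runs of \<open>D12_34\<close>
  and \<open>D23_14\<close>.\<close>

definition kernel_flag :: "simple \<Rightarrow> bool \<Rightarrow> bool" where
  "kernel_flag s b \<longleftrightarrow> s = D13 \<or> s = D24 \<or> (s = D12_34 \<or> s = D23_14) \<and> b"

definition has_kernel :: "int^3^3 \<Rightarrow> simple \<Rightarrow> bool \<Rightarrow> bool" where
  "has_kernel M s b \<longleftrightarrow> (\<forall>v. M *v v = 0 \<longleftrightarrow> leading_kernel s b (v $ 1) (v $ 2) (v $ 3))"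

text \<open>The left side describes the preimage of the old kernel under
  \<open>linear_part t\<close>. That it depends on \<open>s\<close> only through the flag is a
  finite check of linear equations over the permitted pairs, and it is what makes the induction
  close.\<close>

lemma leading_kernel_step:
  assumes "t \<in> set (successors s)"
  shows "leading_kernel s b ((linear_part t *v v) $ 1) ((linear_part t *v v) $ 2) ((linear_part t *v v) $ 3)
    \<longleftrightarrow> leading_kernel t (kernel_flag s b) (v $ 1) (v $ 2) (v $ 3)"
  using assms
  by (cases s; cases t; simp add: matrix_vector_mult_def sum_3 kernel_flag_def; auto)

lemma has_kernel_step:
  "has_kernel M s b \<Longrightarrow> t \<in> set (successors s) \<Longrightarrow> has_kernel (M ** linear_part t) t (kernel_flag s b)"
  by (simp add: has_kernel_def leading_kernel_step flip: matrix_vector_mul_assoc)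

text \<open>Test vectors separate the kernels. The six single bands have planes, recognized by two
  independent vectors and tested before the rest. Both variants of \<open>D12_34\<close> contain (0,
  1, 0) and both variants of \<open>D23_14\<close> contain (1, 0, -1), so the flag does not affect
  the answer.\<close>

definition kernel_factor :: "(int \<Rightarrow> int \<Rightarrow> int \<Rightarrow> bool) \<Rightarrow> simple" where
  "kernel_factor K =
    (if K 1 0 0 \<and> K 0 1 0 then D34 else if K 1 0 0 \<and> K 0 0 1 then D23
     else if K 0 1 0 \<and> K 0 0 1 then D12 else if K 0 0 1 \<and> K 1 (- 1) 0 then D13
     else if K 1 0 0 \<and> K 0 1 (- 1) then D24 else if K 1 (- 1) 0 \<and> K 0 1 (- 1) then D14
     else if K 0 1 0 then D12_34 else if K 0 0 1 then D123 else if K 1 0 0 then D234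
     else if K 0 1 (- 1) then D124 else if K 1 0 (- 1) then D23_14
     else if K 1 (- 1) 0 then D134 else Delta)"

lemma kernel_factor_leading_kernel: "kernel_factor (leading_kernel s b) = s"
  by (cases s; cases b; simp add: kernel_factor_def)

lemma has_kernel_inj:
  assumes "has_kernel M s b" "has_kernel M t c"
  shows "s = t"
proof -
  have "leading_kernel s b x y z \<longleftrightarrow> leading_kernel t c x y z" for x y z
    using assms[unfolded has_kernel_def, THEN spec, of "vector [x, y, z]"] by simp
  then have "leading_kernel s b = leading_kernel t c" by (intro ext) simp
  then have "kernel_factor (leading_kernel s b) = kernel_factor (leading_kernel t c)" by (rule arg_cong)
  then show ?thesis unfolding kernel_factor_leading_kernel .
qed

lemma has_kernel_nonzero:
  assumes "has_kernel M s b"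
  shows "M \<noteq> 0"
proof
  assume "M = 0"
  then have K: "leading_kernel s b x y z" for x y z
    using assms[unfolded has_kernel_def, THEN spec, of "vector [x, y, z]"] by simp
  show False
    using K[of 1 0 0] K[of 0 1 0] K[of 0 0 1] by (cases s; cases b; simp)
qed

definition simples_braid :: "simple list \<Rightarrow> braid4" where
  "simples_braid ss = prod_list (map simple_braid ss)"

text \<open>A virtual \<open>Delta\<close> in front gives the induction its start: the empty product
  has the identity as leading matrix, whose zero kernel is the one listed for \<open>Delta\<close>,
  and every simple element may follow \<open>Delta\<close>.\<close>

lemma leading_matrix:
  assumes "good_sequence (Delta # ss)"
  shows "deg_le (burau (simples_braid ss)) (int (length ss)) \<and>
    (\<exists>b. has_kernel (coeff_matrix (burau (simples_braid ss)) (int (length ss))) (last (Delta # ss)) b)"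
  using assms
proof (induction ss rule: rev_induct)
  case Nil
  have mat_1: "coeff_matrix (mat 1) 0 = mat 1"
    by (simp add: coeff_matrix_def mat_def vec_eq_iff lookup_one)
  have "has_kernel (coeff_matrix (mat 1) 0) Delta b" for b
    unfolding has_kernel_def mat_1 by (simp add: vec_eq_iff[of _ 0] forall_3)
  moreover have "deg_le (mat 1) 0"
    by (simp add: deg_le_def mat_def lookup_one)
  ultimately show ?case by (simp add: simples_braid_def burau_one)
next
  case (snoc s ss)
  let ?M = "burau (simples_braid ss)"
  have "good_sequence (Delta # ss)" and s: "s \<in> set (successors (last (Delta # ss)))"
    using snoc.prems successively_append_iff[of _ "Delta # ss" "[s]"] by simp_all
  then obtain b where "deg_le ?M (int (length ss))"
    "has_kernel (coeff_matrix ?M (int (length ss))) (last (Delta # ss)) b"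
    using snoc.IH by blast
  moreover have "burau (simples_braid (ss @ [s])) = ?M ** burau (simple_braid s)"
    by (simp add: simples_braid_def burau_mult)
  ultimately show ?case
    using has_kernel_step[OF _ s] deg_le_mult_simple coeff_matrix_mult_simple
    by (auto simp: add.commute[of 1])
qed

section \<open>Powers of \<open>delta\<close>, including negative ones\<close>

lemma burau_delta: "burau delta = (\<chi> i j. lin (const_part Delta $ i $ j) (linear_part Delta $ i $ j))"
  using burau_simple[of Delta] by (simp add: simple_braid_Delta)

text \<open>\<open>delta ^ 4\<close> is the full twist, which is central in the braid group; its
  matrix is scalar.\<close>

lemma burau_delta_4: "burau (delta ^ 4) = shift_matrix 4 (mat 1)"
proof -
  have q: "qvar * (qvar * (qvar * qvar)) = Poly_Mapping.single 4 1"
    by (simp add: qvar_def mult_single)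
  have "delta ^ 4 = delta * (delta * (delta * delta))"
    by (simp add: power4_eq_xxxx mult.assoc)
  then show ?thesis
    by (simp add: burau_mult burau_delta shift_matrix_def mat_def vec_eq_iff matrix_matrix_mult_def
        forall_3 sum_3 lin_simps algebra_simps q)
qed

lemma burau_inverse_delta: "burau (inverse delta) = shift_matrix (- 4) (burau (delta ^ 3))"
proof -
  have "delta ^ 3 = inverse delta * delta ^ 4"
    by (simp add: numeral_eq_Suc)
  then have "burau (delta ^ 3) = shift_matrix 4 (burau (inverse delta))"
    by (simp add: burau_mult burau_delta_4 shift_matrix_mult)
  then show ?thesis by (simp add: shift_matrix_add)
qed

lemma burau_inverse_delta_power:
  "burau (inverse delta ^ k) = shift_matrix (- 4 * int k) (burau (delta ^ (3 * k)))"
proof (induction k)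
  case (Suc k)
  have "3 * Suc k = 3 + 3 * k" by simp
  then show ?case
    by (simp only: power_Suc burau_mult burau_inverse_delta Suc shift_matrix_mult shift_matrix_add power_add)
      (simp add: algebra_simps)
qed simp

text \<open>For negative \<open>p\<close>, the matrix of \<open>delta powi p\<close> is that of 3
  |p| factors \<open>Delta\<close> shifted by q^(-4 |p|). For other \<open>p\<close> there is no
  shift and there are \<open>p\<close> factors. In both cases shift and number of factors add up to
  \<open>p\<close>, which gives the degree.\<close>

definition delta_shift :: "int \<Rightarrow> int" where
  "delta_shift p = - 4 * int (nat (- p))"

definition delta_count :: "int \<Rightarrow> nat" where
  "delta_count p = nat p + 3 * nat (- p)"

lemma simples_braid_append: "simples_braid (ss @ ts) = simples_braid ss * simples_braid ts"
  by (simp add: simples_braid_def)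

lemma simples_braid_replicate_Delta: "simples_braid (replicate n Delta) = delta ^ n"
  by (simp add: simples_braid_def simple_braid_Delta prod_list_replicate)

lemma burau_delta_powi_mult:
  "burau (delta powi p * simples_braid ss) =
    shift_matrix (delta_shift p) (burau (simples_braid (replicate (delta_count p) Delta @ ss)))"
  by (cases "p \<ge> 0")
    (simp_all add: power_int_def delta_shift_def delta_count_def simples_braid_append
      simples_braid_replicate_Delta burau_mult burau_inverse_delta_power shift_matrix_mult)

lemma successors_Delta: "s \<in> set (successors Delta)"
  by (cases s) simp_all

lemma good_sequence_Delta_Cons: "good_sequence ss \<Longrightarrow> good_sequence (Delta # ss)"
  by (cases ss) (simp_all add: successors_Delta del: successors.simps)

lemma good_sequence_replicate_Delta:
  "good_sequence ss \<Longrightarrow> good_sequence (replicate n Delta @ ss)"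
  by (induction n) (simp_all add: good_sequence_Delta_Cons)

lemma normal_form_leading_matrix:
  fixes p :: int
  assumes "good_sequence ss"
  defines "M \<equiv> burau (delta powi p * simples_braid ss)" and "n \<equiv> p + int (length ss)"
  shows "deg_le M n" "\<exists>b. has_kernel (coeff_matrix M n) (last (Delta # ss)) b"
proof -
  let ?ts = "replicate (delta_count p) Delta @ ss"
  have good: "good_sequence (Delta # ?ts)"
    by (intro good_sequence_Delta_Cons good_sequence_replicate_Delta assms(1))
  have n: "n = int (length ?ts) + delta_shift p"
    by (simp add: n_def delta_shift_def delta_count_def)
  have last: "last (Delta # ?ts) = last (Delta # ss)"
    by (induction "delta_count p") auto
  show "deg_le M n"
    unfolding M_def n burau_delta_powi_mult using leading_matrix[OF good] by (intro deg_le_shift) simp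
  show "\<exists>b. has_kernel (coeff_matrix M n) (last (Delta # ss)) b"
    unfolding M_def n burau_delta_powi_mult coeff_matrix_shift
    using leading_matrix[OF good] unfolding last by (simp del: length_append)
qed

lemma normal_form_degree:
  assumes "good_sequence ss"
  shows "mat_max_deg (burau (delta powi p * simples_braid ss)) = Fin (p + int (length ss))"
proof -
  let ?M = "burau (delta powi p * simples_braid ss)" and ?n = "p + int (length ss)"
  have deg: "deg_le ?M ?n" by (rule normal_form_leading_matrix[OF assms])
  have "coeff_matrix ?M ?n \<noteq> 0"
    using normal_form_leading_matrix(2)[OF assms] has_kernel_nonzero by blast
  then obtain i j where ij: "Poly_Mapping.lookup (?M $ i $ j) ?n \<noteq> 0"
    by (auto simp: coeff_matrix_def vec_eq_iff)
  have le: "max_deg (?M $ k $ l) \<le> Fin ?n" for k l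
    using deg by (auto simp: max_deg_def deg_le_def in_keys_iff not_less intro!: Max.boundedI) (meson not_less)
  have "?n \<le> Max (Poly_Mapping.keys (?M $ i $ j))"
    using ij by (intro Max_ge) (auto simp: in_keys_iff)
  moreover have "?M $ i $ j \<noteq> 0" using ij by auto
  ultimately have "Fin ?n = max_deg (?M $ i $ j)"
    using le[of i j] by (intro antisym) (auto simp: max_deg_def)
  then have "Fin ?n \<in> {max_deg (?M $ i $ j) |i j. True}" by blast
  moreover have "finite {max_deg (?M $ i $ j) |i j. True}"
    by (rule finite_subset[of _ "(\<lambda>(i, j). max_deg (?M $ i $ j)) ` UNIV"]) auto
  ultimately show ?thesis
    unfolding mat_max_deg_def using le by (intro Max_eqI) blast+
qed

section \<open>Uniqueness of the sequence with a given matrix\<close>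

lemma normal_form_last_eq:
  fixes p r :: int
  assumes "good_sequence ss" "good_sequence ts"
    and eq: "burau (delta powi p * simples_braid ss) = burau (delta powi r * simples_braid ts)"
  shows "p + int (length ss) = r + int (length ts)" "last (Delta # ss) = last (Delta # ts)"
proof -
  show n: "p + int (length ss) = r + int (length ts)"
    using normal_form_degree[OF assms(1), of p] normal_form_degree[OF assms(2), of r] eq by simp
  obtain b c where
    "has_kernel (coeff_matrix (burau (delta powi p * simples_braid ss)) (p + int (length ss)))
      (last (Delta # ss)) b"
    "has_kernel (coeff_matrix (burau (delta powi r * simples_braid ts)) (r + int (length ts)))
      (last (Delta # ts)) c"
    using normal_form_leading_matrix(2)[OF assms(1)] normal_form_leading_matrix(2)[OF assms(2)] by blast
  then show "last (Delta # ss) = last (Delta # ts)" unfolding eq n by (rule has_kernel_inj)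
qed

text \<open>Excluding \<open>Delta\<close> from the factors makes the virtual \<open>Delta\<close>
  in front recognizable: if the kernel gives \<open>Delta\<close>, no factor is left, and the degree
  then determines the power of \<open>delta\<close>.\<close>

lemma normal_form_unique:
  assumes "good_sequence ss" "good_sequence ts" "Delta \<notin> set ss" "Delta \<notin> set ts"
    and "burau (delta powi p * simples_braid ss) = burau (delta powi r * simples_braid ts)"
  shows "p = r \<and> ss = ts"
  using assms
proof (induction ss arbitrary: ts rule: rev_induct)
  case Nil
  have n: "p = r + int (length ts)" and "last (Delta # ts) = Delta"
    using normal_form_last_eq[OF Nil.prems(1,2,5)] by simp_all
  have "ts = []"
  proof (rule ccontr)
    assume "ts \<noteq> []"
    then have "last (Delta # ts) \<in> set ts" by simp
    with \<open>last (Delta # ts) = Delta\<close> Nil.prems(4) show False by metis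
  qed
  then show ?case using n by simp
next
  case (snoc s ss)
  have s: "last (Delta # ts) = s"
    using normal_form_last_eq[OF snoc.prems(1,2,5)] by simp
  then have "ts \<noteq> []" using snoc.prems(3) by auto
  then obtain us where ts: "ts = us @ [s]" using s by (cases ts rule: rev_cases) auto
  \<comment> \<open>Both sequences end with the same \<open>s\<close>, so multiplying on the right
    by the inverse of its matrix shortens both.\<close>
  have peel: "burau (delta powi k * simples_braid vs) =
      burau (delta powi k * simples_braid (vs @ [s])) ** burau (inverse (simple_braid s))" for k vs
    by (simp add: simples_braid_def mult.assoc flip: burau_mult)
  have "p = r \<and> ss = us"
  proof (rule snoc.IH)
    show "good_sequence ss" "good_sequence us"
      using snoc.prems(1,2) by (simp_all add: ts successively_append_iff)
    show "Delta \<notin> set ss" "Delta \<notin> set us" using snoc.prems(3,4) by (simp_all add: ts)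
    show "burau (delta powi p * simples_braid ss) = burau (delta powi r * simples_braid us)"
      using snoc.prems(5) unfolding ts peel[of p ss] peel[of r us] by simp
  qed
  then show ?case by (simp add: ts)
qed

section \<open>Closure properties of recursive functions\<close>

definition recursive_fun :: "nat \<Rightarrow> (nat list \<Rightarrow> nat) \<Rightarrow> bool" where
  "recursive_fun n f \<longleftrightarrow> (\<exists>alg. \<forall>xs. length xs = n \<longrightarrow> computes alg xs (f xs))"

definition recursive1 :: "(nat \<Rightarrow> nat) \<Rightarrow> bool" where
  "recursive1 f \<longleftrightarrow> recursive_fun 1 (\<lambda>xs. f (xs ! 0))"

abbreviation recursive2 :: "(nat \<Rightarrow> nat \<Rightarrow> nat) \<Rightarrow> bool" where
  "recursive2 f \<equiv> recursive_fun 2 (\<lambda>xs. f (xs ! 0) (xs ! 1))"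

lemma length_2E: "length xs = 2 \<Longrightarrow> (\<And>a b. xs = [a, b] \<Longrightarrow> P) \<Longrightarrow> P"
  by (auto simp: numeral_eq_Suc length_Suc_conv)

lemma recursive_fun_nth: "i < n \<Longrightarrow> recursive_fun n (\<lambda>xs. xs ! i)"
  unfolding recursive_fun_def by (intro exI[of _ "Proj i"]) (auto intro: computes.Proj)

lemma recursive_fun_comp1:
  assumes "recursive1 h" "recursive_fun n f"
  shows "recursive_fun n (\<lambda>xs. h (f xs))"
proof -
  obtain H F where H: "\<And>xs. length xs = 1 \<Longrightarrow> computes H xs (h (xs ! 0))"
    and F: "\<And>xs. length xs = n \<Longrightarrow> computes F xs (f xs)"
    using assms unfolding recursive1_def recursive_fun_def by blast
  have "computes (Comp H [F]) xs (h (f xs))" if "length xs = n" for xs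
    using H[of "[f xs]"] F[OF that] by (intro computes.Comp[of "[f xs]"]) auto
  then show ?thesis unfolding recursive_fun_def by blast
qed

lemma recursive_fun_comp2:
  assumes "recursive2 h" "recursive_fun n f" "recursive_fun n g"
  shows "recursive_fun n (\<lambda>xs. h (f xs) (g xs))"
proof -
  obtain H F G where H: "\<And>xs. length xs = 2 \<Longrightarrow> computes H xs (h (xs ! 0) (xs ! 1))"
    and F: "\<And>xs. length xs = n \<Longrightarrow> computes F xs (f xs)"
    and G: "\<And>xs. length xs = n \<Longrightarrow> computes G xs (g xs)"
    using assms unfolding recursive_fun_def by blast
  have "computes (Comp H [F, G]) xs (h (f xs) (g xs))" if "length xs = n" for xs
    using H[of "[f xs, g xs]"] F[OF that] G[OF that]
    by (intro computes.Comp[of "[f xs, g xs]"]) (auto simp: less_Suc_eq)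
  then show ?thesis unfolding recursive_fun_def by blast
qed

lemma recursive1_Suc: "recursive1 Suc"
  unfolding recursive1_def recursive_fun_def
  by (intro exI[of _ Succ]) (auto simp: length_Suc_conv intro: computes.Succ)

lemma recursive_fun_const: "recursive_fun n (\<lambda>_. c)"
proof (induction c)
  case 0
  show ?case unfolding recursive_fun_def by (auto intro: computes.Zero)
next
  case (Suc c)
  then show ?case by (rule recursive_fun_comp1[OF recursive1_Suc])
qed

lemma recursive2_rec_nat:
  assumes "recursive1 a" "recursive_fun 3 (\<lambda>xs. g (xs ! 0) (xs ! 1) (xs ! 2))"
  shows "recursive2 (\<lambda>n x. rec_nat (a x) (\<lambda>m r. g m r x) n)"
proof -
  obtain A G where A: "\<And>xs. length xs = 1 \<Longrightarrow> computes A xs (a (xs ! 0))"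
    and G: "\<And>xs. length xs = 3 \<Longrightarrow> computes G xs (g (xs ! 0) (xs ! 1) (xs ! 2))"
    using assms unfolding recursive1_def recursive_fun_def by blast
  have "computes (PrimRec A G) [n, x] (rec_nat (a x) (\<lambda>m r. g m r x) n)" for n x
  proof (induction n)
    case 0
    show ?case using A[of "[x]"] by (auto intro: computes.PrimRec_0)
  next
    case (Suc n)
    show ?case
      using G[of "[n, rec_nat (a x) (\<lambda>m r. g m r x) n, x]"]
      by (auto intro: computes.PrimRec_Suc[OF Suc.IH])
  qed
  then show ?thesis
    unfolding recursive_fun_def by (intro exI[of _ "PrimRec A G"]) (auto elim!: length_2E)
qed

lemma recursive1_const: "recursive1 (\<lambda>_. c)"
  unfolding recursive1_def by (rule recursive_fun_const)

lemma recursive1_id: "recursive1 (\<lambda>x. x)"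
  unfolding recursive1_def by (rule recursive_fun_nth) simp

lemma recursive1_comp1: "recursive1 h \<Longrightarrow> recursive1 f \<Longrightarrow> recursive1 (\<lambda>x. h (f x))"
  unfolding recursive1_def[of f] recursive1_def[of "\<lambda>x. h (f x)"] by (rule recursive_fun_comp1)

lemma recursive1_comp2:
  "recursive2 h \<Longrightarrow> recursive1 f \<Longrightarrow> recursive1 g \<Longrightarrow> recursive1 (\<lambda>x. h (f x) (g x))"
  unfolding recursive1_def by (rule recursive_fun_comp2)

lemma recursive2_flip: "recursive2 f \<Longrightarrow> recursive2 (\<lambda>x y. f y x)"
  by (rule recursive_fun_comp2) (simp_all add: recursive_fun_nth)

lemma recursive2_add: "recursive2 (+)"
proof -
  have "recursive2 (\<lambda>n x. rec_nat x (\<lambda>m r. Suc r) n)"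
    by (rule recursive2_rec_nat) (simp_all add: recursive1_id recursive_fun_nth recursive_fun_comp1[OF recursive1_Suc])
  also have "(\<lambda>n x. rec_nat x (\<lambda>m r. Suc r) n) = (+)"
  proof (intro ext)
    show "rec_nat x (\<lambda>m r. Suc r) n = n + x" for n x by (induction n) auto
  qed
  finally show ?thesis .
qed

lemma recursive2_mult: "recursive2 (*)"
proof -
  have "recursive2 (\<lambda>n x. rec_nat 0 (\<lambda>m r. x + r) n)"
    by (rule recursive2_rec_nat)
      (simp_all add: recursive_fun_nth recursive1_const recursive_fun_comp2[OF recursive2_add])
  also have "(\<lambda>n x. rec_nat 0 (\<lambda>m r. x + r) n) = (*)"
  proof (intro ext)
    show "rec_nat 0 (\<lambda>m r. x + r) n = n * x" for n x by (induction n) auto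
  qed
  finally show ?thesis .
qed

lemma recursive1_pred: "recursive1 (\<lambda>n. n - 1)"
proof -
  have "recursive2 (\<lambda>n x. rec_nat 0 (\<lambda>m r. m) n)"
    by (rule recursive2_rec_nat) (simp_all add: recursive_fun_nth recursive1_const)
  also have "(\<lambda>n x. rec_nat 0 (\<lambda>m r. m) n) = (\<lambda>n (x :: nat). n - 1)"
  proof (intro ext)
    show "rec_nat 0 (\<lambda>m r. m) n = n - 1" for n by (cases n) auto
  qed
  finally have "recursive2 (\<lambda>n (x :: nat). n - 1)" .
  from recursive_fun_comp2[OF this recursive_fun_nth[of 0 1] recursive_fun_nth[of 0 1]]
  show ?thesis by (simp add: recursive1_def)
qed

lemma recursive2_diff: "recursive2 (-)"
proof -
  have "recursive2 (\<lambda>n x. rec_nat x (\<lambda>m r. r - 1) n)"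
    by (rule recursive2_rec_nat) (simp_all add: recursive1_id recursive_fun_nth recursive_fun_comp1[OF recursive1_pred] del: One_nat_def)
  also have "(\<lambda>n x. rec_nat x (\<lambda>m r. r - 1) n) = (\<lambda>n x. x - n)"
  proof (intro ext)
    show "rec_nat x (\<lambda>m r. r - 1) n = x - n" for n x :: nat by (induction n) auto
  qed
  finally show ?thesis by (rule recursive2_flip)
qed

section \<open>Recursiveness of the pairing function and its projections\<close>

lemma recursive1_triangle: "recursive1 triangle"
proof -
  have "recursive2 (\<lambda>n x. rec_nat 0 (\<lambda>m r. Suc m + r) n)"
    by (rule recursive2_rec_nat)
      (intro recursive1_const recursive_fun_nth
        recursive_fun_comp2[OF recursive2_add] recursive_fun_comp1[OF recursive1_Suc]; simp)+
  also have "(\<lambda>n x. rec_nat 0 (\<lambda>m r. Suc m + r) n) = (\<lambda>n (x :: nat). triangle n)"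
  proof (intro ext)
    show "rec_nat 0 (\<lambda>m r. Suc m + r) n = triangle n" for n by (induction n) auto
  qed
  finally have "recursive2 (\<lambda>n (x :: nat). triangle n)" .
  from recursive_fun_comp2[OF this recursive_fun_nth[of 0 1] recursive_fun_nth[of 0 1]]
  show ?thesis by (simp add: recursive1_def)
qed

text \<open>This inverts \<open>triangle\<close>, rounding down. Truncated subtraction acts as the
  test: the added term is 1 exactly if \<open>triangle (Suc r) \<le> Suc m\<close>.\<close>

definition triangle_root :: "nat \<Rightarrow> nat" where
  "triangle_root n = rec_nat 0 (\<lambda>m r. r + (1 - (triangle (Suc r) - Suc m))) n"

lemma triangle_root_le: "triangle (triangle_root n) \<le> n \<and> n < triangle (Suc (triangle_root n))"
proof (induction n)
  case (Suc n)
  show ?case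
  proof (cases "triangle (Suc (triangle_root n)) \<le> Suc n")
    case True
    then have "triangle_root (Suc n) = Suc (triangle_root n)" by (simp add: triangle_root_def)
    then show ?thesis using True Suc by simp
  next
    case False
    then have "triangle_root (Suc n) = triangle_root n" by (simp add: triangle_root_def)
    then show ?thesis using False Suc by simp
  qed
qed (simp add: triangle_root_def)

lemma triangle_mono: "m \<le> n \<Longrightarrow> triangle m \<le> triangle n"
  by (induction rule: dec_induct) auto

lemma triangle_root_prod_encode: "triangle_root (prod_encode (a, b)) = a + b"
proof -
  let ?k = "triangle_root (prod_encode (a, b))"
  have "prod_encode (a, b) < triangle (Suc (a + b))" by (simp add: prod_encode_def)
  then have "\<not> Suc (a + b) \<le> ?k"
    using triangle_root_le[of "prod_encode (a, b)"] triangle_mono[of "Suc (a + b)" ?k] by linarith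
  moreover have "triangle (a + b) \<le> prod_encode (a, b)" by (simp add: prod_encode_def)
  then have "\<not> Suc ?k \<le> a + b"
    using triangle_root_le[of "prod_encode (a, b)"] triangle_mono[of "Suc ?k" "a + b"] by linarith
  ultimately show ?thesis by simp
qed

definition pfst :: "nat \<Rightarrow> nat" where "pfst n = fst (prod_decode n)"
definition psnd :: "nat \<Rightarrow> nat" where "psnd n = snd (prod_decode n)"

lemma pfst_prod_encode [simp]: "pfst (prod_encode (a, b)) = a"
  and psnd_prod_encode [simp]: "psnd (prod_encode (a, b)) = b"
  by (simp_all add: pfst_def psnd_def)

lemma prod_encode_pfst_psnd: "prod_encode (pfst n, psnd n) = n"
  by (simp add: pfst_def psnd_def)

text \<open>The code of (a, b) is \<open>triangle (a + b) + a\<close>, so the root recovers a + b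
  and the remainder is a.\<close>

lemma pfst_eq: "pfst n = n - triangle (triangle_root n)"
  and psnd_eq: "psnd n = triangle_root n - pfst n"
proof -
  obtain a b where n: "n = prod_encode (a, b)" by (metis prod_encode_pfst_psnd)
  show "pfst n = n - triangle (triangle_root n)" "psnd n = triangle_root n - pfst n"
    by (simp_all add: n triangle_root_prod_encode) (simp add: prod_encode_def)
qed

lemma recursive1_triangle_root: "recursive1 triangle_root"
proof -
  have "recursive2 (\<lambda>n x. rec_nat 0 (\<lambda>m r. r + (1 - (triangle (Suc r) - Suc m))) n)"
    by (rule recursive2_rec_nat)
      (intro recursive1_const recursive_fun_const recursive_fun_nth
        recursive_fun_comp2[OF recursive2_add] recursive_fun_comp2[OF recursive2_diff]
        recursive_fun_comp1[OF recursive1_triangle] recursive_fun_comp1[OF recursive1_Suc]; simp)+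
  then have "recursive2 (\<lambda>n (x :: nat). triangle_root n)"
    by (simp only: triangle_root_def)
  from recursive_fun_comp2[OF this recursive_fun_nth[of 0 1] recursive_fun_nth[of 0 1]]
  show ?thesis by (simp add: recursive1_def)
qed

lemma recursive1_pfst: "recursive1 pfst"
  unfolding recursive1_def pfst_eq
  by (intro recursive_fun_nth recursive_fun_comp2[OF recursive2_diff]
      recursive_fun_comp1[OF recursive1_triangle] recursive_fun_comp1[OF recursive1_triangle_root]) auto

lemma recursive1_psnd: "recursive1 psnd"
  unfolding recursive1_def psnd_eq
  by (intro recursive_fun_nth recursive_fun_comp2[OF recursive2_diff]
      recursive_fun_comp1[OF recursive1_pfst] recursive_fun_comp1[OF recursive1_triangle_root]) auto

lemma recursive2_prod_encode: "recursive2 (\<lambda>a b. prod_encode (a, b))"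
  unfolding prod_encode_def prod.case
  by (intro recursive_fun_nth recursive_fun_comp2[OF recursive2_add]
      recursive_fun_comp1[OF recursive1_triangle]) auto

text \<open>Several arguments of a function are packed into one number by \<open>prod_encode\<close>, so that closure
  properties of unary functions suffice.\<close>

lemmas recursive1_intros =
  recursive1_const recursive1_id
  recursive1_comp2[OF recursive2_add] recursive1_comp2[OF recursive2_mult]
  recursive1_comp2[OF recursive2_diff] recursive1_comp2[OF recursive2_prod_encode]
  recursive1_comp1[OF recursive1_Suc] recursive1_comp1[OF recursive1_pfst]
  recursive1_comp1[OF recursive1_psnd]

lemma recursive1_rec_nat:
  assumes "recursive1 a" "recursive1 n"
    and "recursive1 (\<lambda>y. g (pfst y) (pfst (psnd y)) (psnd (psnd y)))"
  shows "recursive1 (\<lambda>x. rec_nat (a x) (g x) (n x))"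
proof -
  have "recursive_fun 3 (\<lambda>xs. prod_encode (xs ! 2, prod_encode (xs ! 0, xs ! 1)))"
    by (intro recursive_fun_comp2[OF recursive2_prod_encode] recursive_fun_nth) simp_all
  from recursive_fun_comp1[OF assms(3) this]
  have "recursive_fun 3 (\<lambda>xs. g (xs ! 2) (xs ! 0) (xs ! 1))" by simp
  then have "recursive2 (\<lambda>n x. rec_nat (a x) (\<lambda>m r. g x m r) n)"
    by (rule recursive2_rec_nat[OF assms(1)])
  from recursive1_comp2[OF this assms(2) recursive1_id] show ?thesis by simp
qed

lemma recursive1_if_eq:
  assumes "recursive1 f" "recursive1 g" "recursive1 a" "recursive1 b"
  shows "recursive1 (\<lambda>x. if f x = g x then a x else b x)"
proof -
  \<comment> \<open>The sum of the two truncated differences is the distance of \<open>f x\<close>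
    and \<open>g x\<close>; one minus it is the indicator of equality.\<close>
  have "(\<lambda>x. if f x = g x then a x else b x) =
    (\<lambda>x. (1 - ((f x - g x) + (g x - f x))) * a x + (1 - (1 - ((f x - g x) + (g x - f x)))) * b x)"
    by (auto simp: fun_eq_iff)
  then show ?thesis
    by (simp only:) (intro recursive1_intros assms)
qed

text \<open>This covers every finite table at once, in particular those for the matrices and for the
  permitted pairs, without writing a program for them.\<close>

lemma recursive1_finite_exception:
  assumes "finite {x. f x \<noteq> c}"
  shows "recursive1 f"
proof -
  have "\<forall>f. {x. f x \<noteq> c} \<subseteq> A \<longrightarrow> recursive1 f" if "finite A" for A
    using that
  proof (induction A)
    case empty
    show ?case
    proof (intro allI impI)
      fix f :: "nat \<Rightarrow> nat" assume "{x. f x \<noteq> c} \<subseteq> {}"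
      then have "f = (\<lambda>_. c)" by auto
      then show "recursive1 f" by (simp add: recursive1_const)
    qed
  next
    case (insert a A)
    show ?case
    proof (intro allI impI)
      fix f :: "nat \<Rightarrow> nat" assume "{x. f x \<noteq> c} \<subseteq> insert a A"
      then have "{x. (f(a := c)) x \<noteq> c} \<subseteq> A" by auto
      then have "recursive1 (f(a := c))" using insert by blast
      then have "recursive1 (\<lambda>x. if x = a then f a else (f(a := c)) x)"
        by (intro recursive1_if_eq recursive1_intros)
      moreover have "(\<lambda>x. if x = a then f a else (f(a := c)) x) = f" by auto
      ultimately show "recursive1 f" by simp
    qed
  qed
  from this[OF assms] show ?thesis by blast
qed

lemma recursive1_div2: "recursive1 (\<lambda>x. x div 2)"
proof -
  have "rec_nat 0 (\<lambda>m r. if r + r + 1 = m then Suc r else r) n = n div 2" for n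
    by (induction n) (simp_all, presburger)
  moreover have "recursive1 (\<lambda>x. rec_nat 0 (\<lambda>m r. if r + r + 1 = m then Suc r else r) x)"
    by (intro recursive1_rec_nat recursive1_if_eq recursive1_intros)
  ultimately show ?thesis by simp
qed

section \<open>Integer-valued recursive functions\<close>

definition recursive_int :: "(nat \<Rightarrow> int) \<Rightarrow> bool" where
  "recursive_int f \<longleftrightarrow> recursive1 (\<lambda>x. int_encode (f x))"

text \<open>A non-negative k has code 2 k and -k with k > 0 has code 2 k - 1; under truncated
  subtraction at most one summand is non-zero.\<close>

lemma int_encode_of_nat_diff:
  "int_encode (int a - int b) = 2 * (a - b) + (2 * (b - a) - 1)"
  by (auto simp: int_encode_def sum_encode_def nat_diff_distrib)

text \<open>Representing integers as differences of naturals makes sums and products polynomial in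
  the components, which avoids case distinctions on signs.\<close>

lemma recursive_int_iff:
  "recursive_int f \<longleftrightarrow> (\<exists>a b. recursive1 a \<and> recursive1 b \<and> f = (\<lambda>x. int (a x) - int (b x)))"
proof
  assume f: "recursive_int f"
  define c where "c x = int_encode (f x)" for x
  have c: "recursive1 c" using f by (simp add: recursive_int_def c_def[abs_def])
  define h where "h x = x div 2" for x :: nat
  have h: "recursive1 (\<lambda>x. h (g x))" if "recursive1 g" for g
    unfolding h_def using that by (rule recursive1_comp1[OF recursive1_div2])
  \<comment> \<open>The parity of the code gives the sign: 2 k stands for k and 2 k + 1 for -(k +
    1).\<close>
  have f_eq: "f = (\<lambda>x. int (if h (c x) + h (c x) = c x then h (c x) else 0) -
      int (if h (c x) + h (c x) = c x then 0 else Suc (h (c x))))"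
    by (rule ext) (auto simp: c_def h_def int_encode_def sum_encode_def)
  have "recursive1 (\<lambda>x. if h (c x) + h (c x) = c x then h (c x) else 0)"
    "recursive1 (\<lambda>x. if h (c x) + h (c x) = c x then 0 else Suc (h (c x)))"
    by (intro recursive1_if_eq recursive1_intros h c)+
  then show "\<exists>a b. recursive1 a \<and> recursive1 b \<and> f = (\<lambda>x. int (a x) - int (b x))"
    using f_eq by blast
next
  assume "\<exists>a b. recursive1 a \<and> recursive1 b \<and> f = (\<lambda>x. int (a x) - int (b x))"
  then obtain a b where "recursive1 a" "recursive1 b" "f = (\<lambda>x. int (a x) - int (b x))" by blast
  then show "recursive_int f"
    unfolding recursive_int_def
    by (simp add: int_encode_of_nat_diff) (intro recursive1_intros)
qed

lemma recursive_intI: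
  "recursive1 a \<Longrightarrow> recursive1 b \<Longrightarrow> (\<And>x. f x = int (a x) - int (b x)) \<Longrightarrow> recursive_int f"
  unfolding recursive_int_iff by blast

lemma recursive_intE:
  assumes "recursive_int f"
  obtains a b where "recursive1 a" "recursive1 b" "f = (\<lambda>x. int (a x) - int (b x))"
  using assms unfolding recursive_int_iff by blast

lemma recursive_int_of_nat: "recursive1 f \<Longrightarrow> recursive_int (\<lambda>x. int (f x))"
  by (rule recursive_intI[of f "\<lambda>_. 0"]) (simp_all add: recursive1_const)

lemma recursive_int_const: "recursive_int (\<lambda>_. c)"
  unfolding recursive_int_def by (rule recursive1_const)

lemma recursive_int_decode: "recursive1 f \<Longrightarrow> recursive_int (\<lambda>x. int_decode (f x))"
  by (simp add: recursive_int_def)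

lemma recursive1_int_encode: "recursive_int f \<Longrightarrow> recursive1 (\<lambda>x. int_encode (f x))"
  by (simp add: recursive_int_def)

lemma recursive_int_add: "recursive_int f \<Longrightarrow> recursive_int g \<Longrightarrow> recursive_int (\<lambda>x. f x + g x)"
proof (elim recursive_intE)
  fix a b c d assume *: "recursive1 a" "recursive1 b" "recursive1 c" "recursive1 d"
    "f = (\<lambda>x. int (a x) - int (b x))" "g = (\<lambda>x. int (c x) - int (d x))"
  show "recursive_int (\<lambda>x. f x + g x)"
    by (rule recursive_intI[of "\<lambda>x. a x + c x" "\<lambda>x. b x + d x"])
      ((intro recursive1_intros *)+, simp add: *)
qed

lemma recursive_int_mult: "recursive_int f \<Longrightarrow> recursive_int g \<Longrightarrow> recursive_int (\<lambda>x. f x * g x)"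
proof (elim recursive_intE)
  fix a b c d assume *: "recursive1 a" "recursive1 b" "recursive1 c" "recursive1 d"
    "f = (\<lambda>x. int (a x) - int (b x))" "g = (\<lambda>x. int (c x) - int (d x))"
  show "recursive_int (\<lambda>x. f x * g x)"
    by (rule recursive_intI[of "\<lambda>x. a x * c x + b x * d x" "\<lambda>x. a x * d x + b x * c x"])
      ((intro recursive1_intros *)+, simp add: * algebra_simps)
qed

lemma recursive_int_uminus: "recursive_int f \<Longrightarrow> recursive_int (\<lambda>x. - f x)"
  using recursive_int_mult[OF recursive_int_const[of "-1"], of f] by simp

lemma recursive1_nat: "recursive_int f \<Longrightarrow> recursive1 (\<lambda>x. nat (f x))"
proof (elim recursive_intE)
  fix a b assume *: "recursive1 a" "recursive1 b" "f = (\<lambda>x. int (a x) - int (b x))"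
  have "recursive1 (\<lambda>x. a x - b x)" by (intro recursive1_intros *)
  then show "recursive1 (\<lambda>x. nat (f x))" by (simp add: * nat_minus_as_int)
qed

lemmas recursive_int_intros =
  recursive_int_const recursive_int_of_nat recursive_int_decode recursive_int_add
  recursive_int_mult recursive_int_uminus

lemma recursive_int_finite_support:
  "finite {x. f x \<noteq> 0} \<Longrightarrow> recursive_int f"
  unfolding recursive_int_def
  by (rule recursive1_finite_exception[of _ "int_encode 0"]) (auto simp: inj_eq[OF inj_int_encode])

lemma recursive1_power:
  assumes "recursive1 f" "recursive1 g"
  shows "recursive1 (\<lambda>x. f x ^ g x)"
proof -
  have "rec_nat 1 (\<lambda>m r. b * r) n = b ^ n" for b n :: nat by (induction n) auto
  moreover have "recursive1 (\<lambda>x. rec_nat 1 (\<lambda>m r. f x * r) (g x))"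
    by (intro recursive1_rec_nat recursive1_intros assms recursive1_comp1[OF assms(1)])
  ultimately show ?thesis by simp
qed

section \<open>Decidable predicates, folds over coded lists and unbounded search\<close>

definition recursive_pred :: "(nat \<Rightarrow> bool) \<Rightarrow> bool" where
  "recursive_pred P \<longleftrightarrow> recursive1 (\<lambda>x. if P x then 0 else 1)"

lemma recursive_pred_eq:
  "recursive1 f \<Longrightarrow> recursive1 g \<Longrightarrow> recursive_pred (\<lambda>x. f x = g x)"
  unfolding recursive_pred_def by (intro recursive1_if_eq recursive1_intros)

lemma recursive_pred_int_eq:
  "recursive_int f \<Longrightarrow> recursive_int g \<Longrightarrow> recursive_pred (\<lambda>x. f x = g x)"
  using recursive_pred_eq[OF recursive1_int_encode[of f] recursive1_int_encode[of g]]
  by (simp add: inj_eq[OF inj_int_encode])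

lemma recursive1_if:
  assumes "recursive_pred P" "recursive1 f" "recursive1 g"
  shows "recursive1 (\<lambda>x. if P x then f x else g x)"
proof -
  have "recursive1 (\<lambda>x. if (if P x then 0 else 1 :: nat) = 0 then f x else g x)"
    using assms unfolding recursive_pred_def by (intro recursive1_if_eq recursive1_const)
  also have "(\<lambda>x. if (if P x then 0 else 1 :: nat) = 0 then f x else g x) = (\<lambda>x. if P x then f x else g x)"
    by auto
  finally show ?thesis .
qed

lemma recursive_pred_conj:
  assumes "recursive_pred P" "recursive_pred Q"
  shows "recursive_pred (\<lambda>x. P x \<and> Q x)"
proof -
  have "recursive1 (\<lambda>x. if P x then (if Q x then 0 else 1) else 1)"
    using assms(2) unfolding recursive_pred_def[of Q]
    by (intro recursive1_if[OF assms(1)] recursive1_const)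
  also have "(\<lambda>x. if P x then (if Q x then 0 else 1) else 1) = (\<lambda>x. if P x \<and> Q x then 0 else 1 :: nat)"
    by auto
  finally show ?thesis unfolding recursive_pred_def .
qed

lemma length_le_list_encode: "length xs \<le> list_encode xs"
proof (induction xs)
  case (Cons x xs)
  then show ?case using le_prod_encode_2[of "list_encode xs" x] by simp
qed simp

lemma member_le_list_encode: "x \<in> set xs \<Longrightarrow> x \<le> list_encode xs"
proof (induction xs)
  case (Cons y xs)
  then show ?case
    using le_prod_encode_2[of "list_encode xs" y] le_prod_encode_1[of y "list_encode xs"]
    by auto
qed simp

text \<open>The state is the pair of accumulator and code of the remaining list. The list code
  itself serves as the number of iterations: it is at least the length, and the step does nothing
  once the remaining code is 0, the empty list.\<close>

lemma recursive1_foldl: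
  assumes "recursive1 a" "recursive1 l"
    and "recursive1 (\<lambda>y. f (pfst y) (pfst (psnd y)) (psnd (psnd y)))"
  shows "recursive1 (\<lambda>x. foldl (f x) (a x) (list_decode (l x)))"
proof -
  define step where "step x s = (if psnd s = 0 then s else
    prod_encode (f x (pfst s) (pfst (psnd s - 1)), psnd (psnd s - 1)))" for x s
  have step: "rec_nat (prod_encode (b, list_encode xs)) (\<lambda>m. step x) n =
    prod_encode (foldl (f x) b (take n xs), list_encode (drop n xs))" for x b xs n
  proof (induction n)
    case (Suc n)
    have "rec_nat (prod_encode (b, list_encode xs)) (\<lambda>m. step x) (Suc n) =
      step x (prod_encode (foldl (f x) b (take n xs), list_encode (drop n xs)))"
      using Suc by simp
    also have "\<dots> = prod_encode (foldl (f x) b (take (Suc n) xs), list_encode (drop (Suc n) xs))"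
    proof (cases "n < length xs")
      case True
      then show ?thesis
        by (simp add: step_def take_Suc_conv_app_nth Cons_nth_drop_Suc[symmetric, of n])
    qed (simp add: step_def)
    finally show ?case .
  qed simp
  have "pfst (rec_nat (prod_encode (a x, l x)) (\<lambda>m. step x) (l x)) =
    foldl (f x) (a x) (list_decode (l x))" for x
    using step[of "a x" "list_decode (l x)" x "l x"] length_le_list_encode[of "list_decode (l x)"]
    by simp
  moreover have "recursive1 (\<lambda>y. step (pfst y) (psnd y))"
  proof -
    have "recursive1 (\<lambda>y. prod_encode (pfst y, prod_encode (pfst (psnd y), pfst (psnd (psnd y) - 1))))"
      by (intro recursive1_intros)
    from recursive1_comp1[OF assms(3) this] show ?thesis
      unfolding step_def by (simp, intro recursive1_if_eq recursive1_intros) simp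
  qed
  then have "recursive1 (\<lambda>y. (\<lambda>y. step (pfst y) (psnd y)) (prod_encode (pfst y, psnd (psnd y))))"
    by (rule recursive1_comp1) (intro recursive1_intros)
  then have "recursive1 (\<lambda>x. pfst (rec_nat (prod_encode (a x, l x)) (\<lambda>m. step x) (l x)))"
    by (intro recursive1_intros recursive1_rec_nat assms) simp
  ultimately show ?thesis by simp
qed

text \<open>Truth is coded by 0, so minimization returns the least witness; the test is total, as
  minimization requires below that witness.\<close>

lemma recursive_search:
  assumes "recursive_pred P"
  shows "\<exists>alg. \<forall>e. (\<exists>c. P (prod_encode (c, e))) \<longrightarrow>
    computes alg [e] (LEAST c. P (prod_encode (c, e)))"
proof -
  have "recursive_fun 2 (\<lambda>xs. if P (prod_encode (xs ! 0, xs ! 1)) then 0 else 1)"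
    using assms unfolding recursive_pred_def
    by (rule recursive_fun_comp1) (intro recursive_fun_comp2[OF recursive2_prod_encode] recursive_fun_nth; simp)
  then obtain A where A: "\<And>xs. length xs = 2 \<Longrightarrow>
      computes A xs (if P (prod_encode (xs ! 0, xs ! 1)) then 0 else 1)"
    unfolding recursive_fun_def by blast
  have "computes (Mu A) [e] (LEAST c. P (prod_encode (c, e)))" if "\<exists>c. P (prod_encode (c, e))" for e
  proof (rule computes.Mu)
    show "computes A ((LEAST c. P (prod_encode (c, e))) # [e]) 0"
      using A[of "[LEAST c. P (prod_encode (c, e)), e]"] LeastI_ex[OF that] by simp
    show "\<forall>m < (LEAST c. P (prod_encode (c, e))). \<exists>k > 0. computes A (m # [e]) k"
    proof (intro allI impI)
      fix m assume "m < (LEAST c. P (prod_encode (c, e)))"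
      then show "\<exists>k > 0. computes A (m # [e]) k"
        using A[of "[m, e]"] not_less_Least[of m "\<lambda>c. P (prod_encode (c, e))"]
        by (intro exI[of _ 1]) simp
    qed
  qed
  then show ?thesis by blast
qed

section \<open>Evaluation of Laurent polynomials\<close>

definition laurent_eval :: "real \<Rightarrow> laurent \<Rightarrow> real" where
  "laurent_eval K f = (\<Sum>n\<in>Poly_Mapping.keys f. of_int (Poly_Mapping.lookup f n) * K powi n)"

lemma laurent_eval_superset:
  "finite S \<Longrightarrow> Poly_Mapping.keys f \<subseteq> S \<Longrightarrow>
    laurent_eval K f = (\<Sum>n\<in>S. of_int (Poly_Mapping.lookup f n) * K powi n)"
  unfolding laurent_eval_def by (rule sum.mono_neutral_left) (auto simp: in_keys_iff)

lemma laurent_eval_add: "laurent_eval K (f + g) = laurent_eval K f + laurent_eval K g"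
proof -
  let ?S = "Poly_Mapping.keys f \<union> Poly_Mapping.keys g"
  have "Poly_Mapping.keys (f + g) \<subseteq> ?S" by (rule Poly_Mapping.keys_add)
  then show ?thesis
    by (simp add: laurent_eval_superset[of ?S] lookup_add distrib_right sum.distrib)
qed

lemma laurent_eval_times_single:
  assumes "K \<noteq> 0"
  shows "laurent_eval K (f * Poly_Mapping.single m a) = laurent_eval K f * (of_int a * K powi m)"
proof -
  let ?S = "(\<lambda>n. n + m) ` Poly_Mapping.keys f"
  have "Poly_Mapping.keys (f * Poly_Mapping.single m a) \<subseteq> ?S"
  proof
    fix k assume "k \<in> Poly_Mapping.keys (f * Poly_Mapping.single m a)"
    then have "k - m \<in> Poly_Mapping.keys f" by (auto simp: in_keys_iff lookup_times_single)
    then show "k \<in> ?S" by (rule rev_image_eqI) simp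
  qed
  then have "laurent_eval K (f * Poly_Mapping.single m a) =
      (\<Sum>n\<in>?S. of_int (Poly_Mapping.lookup (f * Poly_Mapping.single m a) n) * K powi n)"
    by (intro laurent_eval_superset) auto
  also have "\<dots> = (\<Sum>n\<in>Poly_Mapping.keys f. of_int (Poly_Mapping.lookup f n * a) * K powi (n + m))"
    by (subst sum.reindex) (auto simp: inj_on_def lookup_times_single)
  also have "\<dots> = laurent_eval K f * (of_int a * K powi m)"
    using assms by (simp add: laurent_eval_def sum_distrib_left sum_distrib_right power_int_add mult_ac)
  finally show ?thesis .
qed

lemma laurent_eval_times_lin:
  "K \<noteq> 0 \<Longrightarrow> laurent_eval K (f * lin a b) = laurent_eval K f * (of_int a + of_int b * K)"
  by (simp add: lin_def distrib_left laurent_eval_add laurent_eval_times_single)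

text \<open>The lowest coefficient is divisible by \<open>K\<close> if \<open>K\<close> is a root.\<close>

lemma laurent_eval_eq_0:
  fixes K :: nat
  assumes "K > 0" "\<And>n. \<bar>Poly_Mapping.lookup f n\<bar> < int K" "laurent_eval (real K) f = 0"
  shows "f = 0"
proof (rule ccontr)
  assume "f \<noteq> 0"
  let ?S = "Poly_Mapping.keys f"
  define m where "m = Min ?S"
  have m: "m \<in> ?S" "\<And>n. n \<in> ?S \<Longrightarrow> m \<le> n"
    using \<open>f \<noteq> 0\<close> by (auto simp: m_def)
  define g where "g n = Poly_Mapping.lookup f n * int K ^ nat (n - m)" for n
  have g: "real_of_int (g n) = of_int (Poly_Mapping.lookup f n) * real K powi n * real K powi (- m)"
    if "n \<in> ?S" for n
  proof -
    have "real K powi n * real K powi (- m) = real K powi (n - m)"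
      using assms(1) by (simp add: power_int_diff power_int_minus field_simps)
    also have "\<dots> = real K ^ nat (n - m)" using m(2)[OF that] by (simp add: power_int_def)
    finally show ?thesis by (simp add: g_def mult.assoc)
  qed
  have "real_of_int (\<Sum>n\<in>?S. g n) = laurent_eval (real K) f * real K powi (- m)"
    by (simp add: laurent_eval_def sum_distrib_right g)
  then have "(\<Sum>n\<in>?S. g n) = 0" using assms(3) by (simp del: of_int_sum)
  then have "g m + (\<Sum>n\<in>?S - {m}. g n) = 0" using m(1) by (simp add: sum.remove)
  moreover have "int K dvd (\<Sum>n\<in>?S - {m}. g n)"
  proof (rule dvd_sum)
    fix n assume "n \<in> ?S - {m}"
    then have "nat (n - m) \<noteq> 0" using m(2)[of n] by auto
    then show "int K dvd g n" by (simp add: g_def dvd_power)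
  qed
  ultimately have "int K dvd g m" by (metis dvd_add_left_iff dvd_0_right)
  then have "int K dvd Poly_Mapping.lookup f m" by (simp add: g_def)
  then have "int K \<le> \<bar>Poly_Mapping.lookup f m\<bar>"
    using m(1) by (intro zdvd_imp_le) (auto simp: in_keys_iff)
  then show False using assms(2)[of m] by simp
qed

lemma laurent_eval_inj:
  fixes K :: nat
  assumes "\<And>n. \<bar>Poly_Mapping.lookup f n\<bar> \<le> int A" "\<And>n. \<bar>Poly_Mapping.lookup g n\<bar> \<le> int B"
    and "A + B < K" "laurent_eval (real K) f = laurent_eval (real K) g"
  shows "f = g"
proof -
  have "\<bar>Poly_Mapping.lookup (f - g) n\<bar> < int K" for n
    using assms(1)[of n] assms(2)[of n] assms(3) by (simp add: lookup_minus)
  moreover have "laurent_eval (real K) (f - g) = 0"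
    using laurent_eval_add[of K "f - g" g] assms(4) by simp
  ultimately have "f - g = 0" using assms(3) by (intro laurent_eval_eq_0) auto
  then show ?thesis by simp
qed

section \<open>The algorithm\<close>

lemma UNIV_simple: "(UNIV :: simple set) =
  {D12, D23, D34, D13, D24, D14, D12_34, D23_14, D123, D124, D234, D134, Delta}"
  by (auto intro: simple.exhaust)

lemma finite_simple: "finite (A :: simple set)"
  by (rule finite_subset[OF subset_UNIV]) (simp add: UNIV_simple)

text \<open>This is the code that \<open>encode_normal_form\<close> gives to such a factor, so a
  candidate of the search is already in output format.\<close>

definition simple_code :: "simple \<Rightarrow> nat" where
  "simple_code s = list_encode (map prod_encode (simple_word s))"

lemma inj_simple_code: "inj simple_code"
proof (rule injI)
  fix s t assume "simple_code s = simple_code t"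
  then have "simple_word s = simple_word t"
    using inj_prod_encode[of UNIV] by (simp add: simple_code_def list_encode_eq inj_map_eq_map)
  then show "s = t" by (cases s; cases t; simp)
qed

lemma simple_code_pos: "simple_code s > 0"
  by (cases s) (simp_all add: simple_code_def)

text \<open>The sum has one term at the code of a simple element and none elsewhere. The result
  vanishes off a finite set and is therefore recursive for every \<open>h\<close>.\<close>

definition simple_table :: "(simple \<Rightarrow> int) \<Rightarrow> nat \<Rightarrow> int" where
  "simple_table h w = (\<Sum>s | simple_code s = w. h s)"

lemma simple_table_code [simp]: "simple_table h (simple_code s) = h s"
proof -
  have "{t. simple_code t = simple_code s} = {s}" using inj_simple_code by (auto dest: injD)
  then show ?thesis by (simp add: simple_table_def)
qed

lemma recursive_int_simple_table:
  assumes "recursive1 f"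
  shows "recursive_int (\<lambda>x. simple_table h (f x))"
proof -
  have "{w. simple_table h w \<noteq> 0} \<subseteq> simple_code ` UNIV"
  proof
    fix w assume "w \<in> {w. simple_table h w \<noteq> 0}"
    then have "{s. simple_code s = w} \<noteq> {}" unfolding simple_table_def by force
    then show "w \<in> range simple_code" by auto
  qed
  then have "finite {w. simple_table h w \<noteq> 0}"
    by (rule finite_subset) (rule finite_imageI[OF finite_simple])
  then have "recursive_int (simple_table h)" by (rule recursive_int_finite_support)
  from recursive1_comp1[OF this[unfolded recursive_int_def] assms]
  show ?thesis unfolding recursive_int_def .
qed

section \<open>Matrix rows at an integer value of q\<close>

definition row_code :: "int \<Rightarrow> int \<Rightarrow> int \<Rightarrow> nat" where
  "row_code a b c = prod_encode (int_encode a, prod_encode (int_encode b, int_encode c))"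

definition row_entry :: "3 \<Rightarrow> nat \<Rightarrow> int" where
  "row_entry j v = int_decode (if j = 1 then pfst v else if j = 2 then pfst (psnd v) else psnd (psnd v))"

lemma row_entry_code [simp]:
  "row_entry 1 (row_code a b c) = a" "row_entry 2 (row_code a b c) = b" "row_entry 3 (row_code a b c) = c"
  by (simp_all add: row_entry_def row_code_def)

text \<open>Right multiplication acts on each row separately, so three integers suffice as state;
  the factor A + q B is used with q = K.\<close>

definition row_step_entry :: "3 \<Rightarrow> nat \<Rightarrow> nat \<Rightarrow> nat \<Rightarrow> int" where
  "row_step_entry j K w v = (\<Sum>l\<in>UNIV. row_entry l v *
    (simple_table (\<lambda>s. const_part s $ l $ j) w + simple_table (\<lambda>s. linear_part s $ l $ j) w * int K))"

definition row_step :: "nat \<Rightarrow> nat \<Rightarrow> nat \<Rightarrow> nat" where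
  "row_step K w v = row_code (row_step_entry 1 K w v) (row_step_entry 2 K w v) (row_step_entry 3 K w v)"

lemma recursive1_row_code:
  "recursive_int f \<Longrightarrow> recursive_int g \<Longrightarrow> recursive_int h \<Longrightarrow> recursive1 (\<lambda>x. row_code (f x) (g x) (h x))"
  unfolding row_code_def by (intro recursive1_intros recursive1_int_encode)

lemma recursive_int_row_entry: "recursive1 f \<Longrightarrow> recursive_int (\<lambda>x. row_entry j (f x))"
  unfolding row_entry_def
  by (cases "j = 1"; cases "j = 2"; simp) (intro recursive_int_decode recursive1_intros; simp)+

lemma recursive1_row_step:
  assumes "recursive1 K" "recursive1 w" "recursive1 v"
  shows "recursive1 (\<lambda>x. row_step (K x) (w x) (v x))"
  unfolding row_step_def row_step_entry_def sum_3
  by (intro recursive1_row_code recursive_int_intros recursive_int_row_entry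
      recursive_int_simple_table assms)

definition row_represents :: "nat \<Rightarrow> nat \<Rightarrow> laurent^3 \<Rightarrow> bool" where
  "row_represents K v R \<longleftrightarrow> (\<forall>j. of_int (row_entry j v) = laurent_eval (real K) (R $ j))"

lemma row_represents_step:
  assumes "row_represents K v (M $ i)" "K > 0"
  shows "row_represents K (row_step K (simple_code s) v) ((M ** burau (simple_braid s)) $ i)"
proof -
  have "of_int (row_step_entry j K (simple_code s) v) =
      laurent_eval (real K) ((M ** burau (simple_braid s)) $ i $ j)" for j
  proof -
    have "(M ** burau (simple_braid s)) $ i $ j =
        (\<Sum>l\<in>UNIV. M $ i $ l * lin (const_part s $ l $ j) (linear_part s $ l $ j))"
      by (simp add: burau_simple matrix_matrix_mult_def)
    then show ?thesis
      using assms by (simp add: row_step_entry_def row_represents_def sum_3 laurent_eval_add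
          laurent_eval_times_lin)
  qed
  then show ?thesis by (simp add: row_represents_def row_step_def forall_3)
qed

text \<open>One transition of a finite automaton reading factor codes: state 0 is the start, 1 is
  rejection, and otherwise the state is the successor of the last code. Codes are positive, so the
  states do not clash and rejection is permanent.\<close>

definition sequence_step :: "nat \<Rightarrow> nat \<Rightarrow> nat" where
  "sequence_step a w =
    (if \<exists>s. w = simple_code s \<and> s \<noteq> Delta \<and>
      (a = 0 \<or> (\<exists>t. a = Suc (simple_code t) \<and> s \<in> set (successors t))) then Suc w else 1)"

lemma recursive1_sequence_step:
  assumes "recursive1 f" "recursive1 g"
  shows "recursive1 (\<lambda>x. sequence_step (f x) (g x))"
proof -
  let ?A = "insert 0 (Suc ` range simple_code)" and ?B = "range simple_code"
  have "{y. sequence_step (pfst y) (psnd y) \<noteq> 1} \<subseteq> prod_encode ` (?A \<times> ?B)"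
  proof
    fix y assume "y \<in> {y. sequence_step (pfst y) (psnd y) \<noteq> 1}"
    then have "(pfst y, psnd y) \<in> ?A \<times> ?B"
      by (auto simp: sequence_step_def split: if_splits)
    then show "y \<in> prod_encode ` (?A \<times> ?B)"
      by (intro rev_image_eqI[of "(pfst y, psnd y)"]) (simp_all add: prod_encode_pfst_psnd)
  qed
  then have "finite {y. sequence_step (pfst y) (psnd y) \<noteq> 1}"
    by (rule finite_subset) (simp add: finite_simple)
  then have "recursive1 (\<lambda>y. sequence_step (pfst y) (psnd y))" by (rule recursive1_finite_exception)
  from recursive1_comp1[OF this recursive1_comp2[OF recursive2_prod_encode assms]]
  show ?thesis by simp
qed

lemma foldl_sequence_step:
  "foldl sequence_step 0 ws =
    (if \<exists>ss. ws = map simple_code ss \<and> good_sequence ss \<and> Delta \<notin> set ss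
     then (if ws = [] then 0 else Suc (last ws)) else 1)"
proof (induction ws rule: rev_induct)
  case (snoc w ws)
  let ?P = "\<lambda>ws. \<exists>ss. ws = map simple_code ss \<and> good_sequence ss \<and> Delta \<notin> set ss"
  show ?case
  proof (cases "?P ws")
    case True
    then obtain ss where ss: "ws = map simple_code ss" "good_sequence ss" "Delta \<notin> set ss" by blast
    have "(\<exists>s. w = simple_code s \<and> s \<noteq> Delta \<and> (ws = [] \<or>
        (\<exists>t. last ws = simple_code t \<and> s \<in> set (successors t)))) \<longleftrightarrow> ?P (ws @ [w])"
    proof
      assume "\<exists>s. w = simple_code s \<and> s \<noteq> Delta \<and> (ws = [] \<or>
        (\<exists>t. last ws = simple_code t \<and> s \<in> set (successors t)))"
      then obtain s where s: "w = simple_code s" "s \<noteq> Delta"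
        "ws = [] \<or> (\<exists>t. last ws = simple_code t \<and> s \<in> set (successors t))" by blast
      then have "ss = [] \<or> s \<in> set (successors (last ss))"
        using ss(1) by (cases "ss = []") (auto simp: last_map inj_eq[OF inj_simple_code])
      then have "good_sequence (ss @ [s])"
        using ss(2) by (auto simp: successively_append_iff)
      then show "?P (ws @ [w])"
        using ss s by (intro exI[of _ "ss @ [s]"]) simp
    next
      assume "?P (ws @ [w])"
      then obtain us where us: "ws @ [w] = map simple_code us" "good_sequence us" "Delta \<notin> set us"
        by blast
      then obtain ts s where ts: "us = ts @ [s]" by (cases us rule: rev_cases) auto
      then show "\<exists>s. w = simple_code s \<and> s \<noteq> Delta \<and> (ws = [] \<or>
        (\<exists>t. last ws = simple_code t \<and> s \<in> set (successors t)))"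
        using us by (intro exI[of _ s]) (auto simp: successively_append_iff last_map)
    qed
    moreover have "foldl sequence_step 0 (ws @ [w]) = sequence_step (if ws = [] then 0 else Suc (last ws)) w"
      using snoc True by simp
    moreover have "sequence_step (if ws = [] then 0 else Suc (last ws)) w =
      (if \<exists>s. w = simple_code s \<and> s \<noteq> Delta \<and> (ws = [] \<or>
        (\<exists>t. last ws = simple_code t \<and> s \<in> set (successors t))) then Suc w else 1)"
      unfolding sequence_step_def by (cases "ws = []") simp_all
    ultimately show ?thesis by (simp only: append_is_Nil_conv not_Cons_self2 simp_thms if_False last_snoc)
  next
    case False
    moreover have "\<not> ?P (ws @ [w])"
    proof
      assume "?P (ws @ [w])"
      then obtain us where us: "ws @ [w] = map simple_code us" "good_sequence us" "Delta \<notin> set us"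
        by blast
      then obtain ts s where ts: "us = ts @ [s]" by (cases us rule: rev_cases) auto
      then have "?P ws" using us by (intro exI[of _ ts]) (auto simp: successively_append_iff)
      then show False using False by blast
    qed
    moreover have "foldl sequence_step 0 (ws @ [w]) = sequence_step 1 w"
      using snoc False by simp
    moreover have "1 \<noteq> Suc (simple_code t)" for t
      using simple_code_pos[of t] by simp
    then have "sequence_step 1 w = 1"
      unfolding sequence_step_def by (metis one_neq_zero)
    ultimately show ?thesis by (simp only: if_False)
  qed
qed simp

lemma foldl_sequence_step_neq_1:
  "foldl sequence_step 0 ws \<noteq> 1 \<longleftrightarrow>
    (\<exists>ss. ws = map simple_code ss \<and> good_sequence ss \<and> Delta \<notin> set ss)"
proof -
  have "last ws > 0" if "ws = map simple_code ss" "ws \<noteq> []" for ss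
    using that simple_code_pos by (simp add: last_map)
  then have "(if ws = [] then 0 else Suc (last ws)) \<noteq> 1" if "ws = map simple_code ss" for ss
    using that by (cases "ws = []") auto
  then show ?thesis
    unfolding foldl_sequence_step
    by (cases "\<exists>ss. ws = map simple_code ss \<and> good_sequence ss \<and> Delta \<notin> set ss") (simp_all only: if_True if_False, blast+)
qed

definition unit_row :: "3 \<Rightarrow> nat" where
  "unit_row i = row_code (if i = 1 then 1 else 0) (if i = 2 then 1 else 0) (if i = 3 then 1 else 0)"

text \<open>The power of \<open>delta\<close> is replaced by \<open>delta_count\<close> factors
  \<open>Delta\<close>, so that all values stay integers. The missing negative power of q is
  accounted for in \<open>entry_test\<close>.\<close>

definition candidate_row :: "3 \<Rightarrow> nat \<Rightarrow> nat \<Rightarrow> nat" where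
  "candidate_row i K c =
    foldl (\<lambda>v w. row_step K w v)
      (rec_nat (unit_row i) (\<lambda>_. row_step K (simple_code Delta)) (delta_count (int_decode (pfst c))))
      (list_decode (psnd c))"

lemma recursive1_candidate_row:
  assumes "recursive1 K" "recursive1 c"
  shows "recursive1 (\<lambda>x. candidate_row i (K x) (c x))"
  unfolding candidate_row_def delta_count_def
  by (intro recursive1_foldl recursive1_rec_nat recursive1_intros recursive1_row_step recursive1_nat
      recursive_int_intros assms recursive1_comp1[OF assms(1)])

lemma row_represents_unit: "row_represents K (unit_row i) (burau (simples_braid []) $ i)"
proof -
  have "laurent_eval (real K) 1 = 1" "laurent_eval (real K) 0 = 0"
    by (simp_all add: laurent_eval_def)
  then show ?thesis
    using exhaust_3[of i]
    by (auto simp: row_represents_def unit_row_def simples_braid_def burau_one mat_def forall_3)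
qed

lemma row_represents_foldl:
  assumes "row_represents K v (burau (simples_braid rs) $ i)" "K > 0"
  shows "row_represents K (foldl (\<lambda>v w. row_step K w v) v (map simple_code ss))
    (burau (simples_braid (rs @ ss)) $ i)"
proof (induction ss rule: rev_induct)
  case (snoc s ss)
  have "burau (simples_braid (rs @ ss @ [s])) = burau (simples_braid (rs @ ss)) ** burau (simple_braid s)"
    by (simp add: simples_braid_def burau_mult mult.assoc flip: burau_mult)
  then show ?case using row_represents_step[OF snoc assms(2), of s] by simp
qed (simp add: assms)

lemma row_represents_candidate:
  assumes "K > 0"
  shows "row_represents K (candidate_row i K (prod_encode (int_encode p, list_encode (map simple_code ss))))
    (burau (simples_braid (replicate (delta_count p) Delta @ ss)) $ i)"
proof -
  have rec: "rec_nat v (\<lambda>_. row_step K w) n = foldl (\<lambda>v w. row_step K w v) v (replicate n w)" for v w n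
  proof (induction n)
    case (Suc n)
    have "replicate (Suc n) w = replicate n w @ [w]" by (simp add: replicate_append_same)
    then show ?case using Suc by (simp del: replicate.simps)
  qed simp
  show ?thesis
    using row_represents_foldl[OF row_represents_unit assms, of i "replicate (delta_count p) Delta @ ss"]
    by (simp add: candidate_row_def rec)
qed

section \<open>Comparing a candidate with the input matrix\<close>

primrec code_nth :: "nat \<Rightarrow> nat \<Rightarrow> nat" where
  "code_nth 0 n = pfst (n - 1)"
| "code_nth (Suc k) n = code_nth k (psnd (n - 1))"

lemma code_nth_list_encode: "k < length xs \<Longrightarrow> code_nth k (list_encode xs) = xs ! k"
  by (induction k arbitrary: xs; case_tac xs) auto

lemma recursive1_code_nth: "recursive1 f \<Longrightarrow> recursive1 (\<lambda>x. code_nth k (f x))"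
proof (induction k arbitrary: f)
  case 0
  then show ?case unfolding code_nth.simps by (intro recursive1_intros)
next
  case (Suc k)
  then show ?case unfolding code_nth.simps by (intro Suc.IH recursive1_intros)
qed

text \<open>Computes K^m times the value at K from a coded polynomial. The exponents are shifted by
  \<open>m\<close> so that the result is an integer; it is kept in coded form, with 0 as the code of
  zero.\<close>

definition polynomial_value :: "nat \<Rightarrow> nat \<Rightarrow> nat \<Rightarrow> nat" where
  "polynomial_value K m l = foldl (\<lambda>a t. int_encode (int_decode a +
    int_decode (psnd t) * int (K ^ nat (int_decode (pfst t) + int m)))) 0 (list_decode l)"

lemma recursive1_polynomial_value:
  assumes "recursive1 K" "recursive1 m" "recursive1 l"
  shows "recursive1 (\<lambda>x. polynomial_value (K x) (m x) (l x))"
  unfolding polynomial_value_def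
  by (intro recursive1_foldl recursive1_intros recursive1_int_encode recursive_int_intros
      recursive1_power recursive1_nat assms recursive1_comp1[OF assms(1)] recursive1_comp1[OF assms(2)])

lemma polynomial_value_encode:
  assumes "K > 0" "\<And>n. n \<in> Poly_Mapping.keys f \<Longrightarrow> \<bar>n\<bar> \<le> int m"
  shows "of_int (int_decode (polynomial_value K m (encode_laurent f))) =
    real K ^ m * laurent_eval (real K) f"
proof -
  let ?h = "\<lambda>n. Poly_Mapping.lookup f n * int (K ^ nat (n + int m))"
  have "int_decode (foldl (\<lambda>a t. int_encode (int_decode a +
      int_decode (psnd t) * int (K ^ nat (int_decode (pfst t) + int m)))) a
      (map (\<lambda>n. prod_encode (int_encode n, int_encode (Poly_Mapping.lookup f n))) ns)) =
      int_decode a + sum_list (map ?h ns)" for a ns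
    by (induction ns arbitrary: a) simp_all
  then have "int_decode (polynomial_value K m (encode_laurent f)) =
      int_decode 0 + sum_list (map ?h (sorted_list_of_set (Poly_Mapping.keys f)))"
    by (simp only: polynomial_value_def encode_laurent_def list_encode_inverse)
  also have "\<dots> = (\<Sum>n\<in>Poly_Mapping.keys f. ?h n)"
    by (simp add: sum_list_distinct_conv_sum_set int_decode_def sum_decode_def)
  finally have "of_int (int_decode (polynomial_value K m (encode_laurent f))) =
      (\<Sum>n\<in>Poly_Mapping.keys f. real_of_int (Poly_Mapping.lookup f n) * real K ^ nat (n + int m))"
    by simp
  also have "\<dots> = (\<Sum>n\<in>Poly_Mapping.keys f. real K ^ m * (real_of_int (Poly_Mapping.lookup f n) * real K powi n))"
  proof (rule sum.cong)
    fix n assume "n \<in> Poly_Mapping.keys f"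
    then have "0 \<le> n + int m" using assms(2)[of n] by linarith
    then have "real K ^ nat (n + int m) = real K powi (n + int m)" by (simp add: power_int_def)
    also have "\<dots> = real K powi n * real K ^ m" using assms(1) by (simp add: power_int_add)
    finally show "real_of_int (Poly_Mapping.lookup f n) * real K ^ nat (n + int m) =
      real K ^ m * (real_of_int (Poly_Mapping.lookup f n) * real K powi n)" by simp
  qed simp
  also have "\<dots> = real K ^ m * laurent_eval (real K) f"
    by (simp add: laurent_eval_def sum_distrib_left)
  finally show ?thesis .
qed

lemma abs_le_int_encode: "\<bar>n\<bar> \<le> int (int_encode n)"
  by (auto simp: int_encode_def sum_encode_def)

text \<open>Pairing and list coding never decrease their arguments, so the input code itself
  supplies bounds for exponents and coefficients.\<close>

lemma encode_laurent_bounds: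
  assumes "n \<in> Poly_Mapping.keys f"
  shows "\<bar>n\<bar> \<le> int (encode_laurent f)" "\<bar>Poly_Mapping.lookup f n\<bar> \<le> int (encode_laurent f)"
proof -
  let ?t = "prod_encode (int_encode n, int_encode (Poly_Mapping.lookup f n))"
  have "?t \<le> encode_laurent f"
    unfolding encode_laurent_def using assms by (intro member_le_list_encode) auto
  then have "int_encode n \<le> encode_laurent f" "int_encode (Poly_Mapping.lookup f n) \<le> encode_laurent f"
    using le_prod_encode_1 le_prod_encode_2 order_trans by blast+
  then show "\<bar>n\<bar> \<le> int (encode_laurent f)" "\<bar>Poly_Mapping.lookup f n\<bar> \<le> int (encode_laurent f)"
    using abs_le_int_encode[of n] abs_le_int_encode[of "Poly_Mapping.lookup f n"] by linarith+
qed

definition matrix_position :: "3 \<Rightarrow> 3 \<Rightarrow> nat" where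
  "matrix_position i j =
    3 * (if i = 1 then 0 else if i = 2 then 1 else 2) + (if j = 1 then 0 else if j = 2 then 1 else 2)"

lemma code_nth_encode_matrix:
  "code_nth (matrix_position i j) (encode_matrix A) = encode_laurent (A $ i $ j)"
  using exhaust_3[of i] exhaust_3[of j]
  by (auto simp: encode_matrix_def matrix_position_def code_nth_list_encode
      simp del: list_encode.simps code_nth.simps)

lemma encode_laurent_le_encode_matrix: "encode_laurent (A $ i $ j) \<le> encode_matrix A"
  unfolding encode_matrix_def using exhaust_3[of i] exhaust_3[of j]
  by (intro member_le_list_encode) auto

text \<open>Each new coefficient is a sum over three columns of two old coefficients, each times an
  entry in {-1, 0, 1}; this gives the factor 6.\<close>

lemma coefficient_bound:
  "\<bar>Poly_Mapping.lookup (burau (simples_braid ss) $ i $ j) k\<bar> \<le> 6 ^ length ss"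
proof (induction ss arbitrary: j k rule: rev_induct)
  case Nil
  show ?case by (simp add: simples_braid_def burau_one mat_def lookup_one when_def)
next
  case (snoc s ss)
  let ?M = "burau (simples_braid ss)"
  have M: "burau (simples_braid (ss @ [s])) = ?M ** burau (simple_braid s)"
    by (simp add: simples_braid_def burau_mult)
  have parts: "\<bar>const_part s $ l $ m\<bar> \<le> 1" "\<bar>linear_part s $ l $ m\<bar> \<le> 1" for l m
    using exhaust_3[of l] exhaust_3[of m] by (cases s; auto)+
  have le: "\<bar>x * y\<bar> \<le> 6 ^ length ss" if "\<bar>x\<bar> \<le> 6 ^ length ss" "\<bar>y\<bar> \<le> 1" for x y :: int
    using mult_mono[OF that] by (simp add: abs_mult)
  have "\<bar>Poly_Mapping.lookup (?M $ i $ l) k * const_part s $ l $ j +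
      Poly_Mapping.lookup (?M $ i $ l) (k - 1) * linear_part s $ l $ j\<bar> \<le> 2 * 6 ^ length ss" for l
    using le[OF snoc[of l k] parts(1)[of l j]] le[OF snoc[of l "k - 1"] parts(2)[of l j]] by linarith
  from this[of 1] this[of 2] this[of 3] show ?case
    unfolding M lookup_mult_simple sum_3 length_append list.size power_add by simp
qed

text \<open>\<open>psnd y\<close> bounds the coefficients of the input and the power of 6 those of
  the candidate; the 1 makes the bound strict.\<close>

definition candidate_bound :: "nat \<Rightarrow> nat" where
  "candidate_bound y = psnd y + 6 ^ (4 * pfst y) + 1"

text \<open>The candidate code is \<open>pfst y\<close>, the matrix code \<open>psnd y\<close>. The number substituted for \<open>q\<close> exceeds
  all coefficients involved, and the shift of the exponents by at least \<open>psnd y\<close> keeps them nonnegative.\<close>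

definition entry_test :: "3 \<Rightarrow> 3 \<Rightarrow> nat \<Rightarrow> bool" where
  "entry_test i j y \<longleftrightarrow>
    int_decode (polynomial_value (candidate_bound y) (psnd y + 4 * nat (- int_decode (pfst (pfst y))))
      (code_nth (matrix_position i j) (psnd y))) =
    int (candidate_bound y ^ psnd y) * row_entry j (candidate_row i (candidate_bound y) (pfst y))"

definition candidate_test :: "nat \<Rightarrow> bool" where
  "candidate_test y \<longleftrightarrow> foldl sequence_step 0 (list_decode (psnd (pfst y))) \<noteq> 1 \<and>
    (\<forall>i j. entry_test i j y)"

lemma recursive_pred_entry_test: "recursive_pred (entry_test i j)"
proof -
  have "recursive_pred (\<lambda>y. entry_test i j y)"
    unfolding entry_test_def candidate_bound_def
    by (intro recursive_pred_int_eq recursive_int_intros recursive1_polynomial_value recursive1_intros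
        recursive1_power recursive1_nat recursive1_code_nth recursive_int_row_entry recursive1_candidate_row)
  then show ?thesis .
qed

lemma recursive_pred_candidate_test: "recursive_pred candidate_test"
proof -
  have "recursive1 (\<lambda>y. if foldl sequence_step 0 (list_decode (psnd (pfst y))) = 1 then 1 else 0)"
    by (intro recursive1_if_eq recursive1_foldl recursive1_sequence_step recursive1_intros)
  moreover have "(\<lambda>y. if foldl sequence_step 0 (list_decode (psnd (pfst y))) \<noteq> 1 then 0 else 1 :: nat) =
      (\<lambda>y. if foldl sequence_step 0 (list_decode (psnd (pfst y))) = 1 then 1 else 0)"
    by auto
  ultimately have "recursive_pred (\<lambda>y. foldl sequence_step 0 (list_decode (psnd (pfst y))) \<noteq> 1)"
    unfolding recursive_pred_def by (simp only:)
  then have "recursive_pred (\<lambda>y. candidate_test y)"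
    unfolding candidate_test_def forall_3 by (intro recursive_pred_conj recursive_pred_entry_test)
  then show ?thesis .
qed

definition candidate_code :: "int \<Rightarrow> simple list \<Rightarrow> nat" where
  "candidate_code p ss = prod_encode (int_encode p, list_encode (map simple_code ss))"

text \<open>With m = 4 nat (-p), the candidate entry is q^(-m) g for a polynomial g. Multiplied by
  K^(e + m), the values at K of both entries become the integers K^(e + m) f(K) and K^e g(K) that
  the test compares, and K is large enough for evaluation to be injective here.\<close>

lemma entry_test_iff:
  "entry_test i j (prod_encode (candidate_code p ss, encode_matrix A)) \<longleftrightarrow>
    A $ i $ j = burau (delta powi p * simples_braid ss) $ i $ j"
proof -
  define c e where "c = candidate_code p ss" and "e = encode_matrix A"
  define f where "f = A $ i $ j"
  define W where "W = replicate (delta_count p) Delta @ ss"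
  define g where "g = burau (simples_braid W) $ i $ j"
  define m where "m = 4 * nat (- p)"
  define K where "K = e + 6 ^ (4 * c) + 1"
  have K: "K > 0" by (simp add: K_def)
  have f_le: "encode_laurent f \<le> e"
    unfolding f_def e_def by (rule encode_laurent_le_encode_matrix)
  have keys: "\<bar>n\<bar> \<le> int (e + m)" if "n \<in> Poly_Mapping.keys f" for n
    using encode_laurent_bounds(1)[OF that] f_le by linarith
  have val: "real_of_int (int_decode (polynomial_value K (e + m) (encode_laurent f))) =
      real K ^ (e + m) * laurent_eval (real K) f"
    by (rule polynomial_value_encode[OF K keys])
  have row: "row_represents K (candidate_row i K c) (burau (simples_braid W) $ i)"
    unfolding c_def candidate_code_def W_def by (rule row_represents_candidate[OF K])
  have entry: "burau (delta powi p * simples_braid ss) $ i $ j = g * Poly_Mapping.single (- int m) 1"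
    by (simp add: burau_delta_powi_mult shift_matrix_def g_def W_def m_def delta_shift_def)
  have "entry_test i j (prod_encode (c, e)) \<longleftrightarrow>
      int_decode (polynomial_value K (e + m) (encode_laurent f)) =
      int (K ^ e) * row_entry j (candidate_row i K c)"
    by (simp add: entry_test_def candidate_bound_def K_def e_def code_nth_encode_matrix f_def m_def
        c_def candidate_code_def)
  also have "\<dots> \<longleftrightarrow> real_of_int (int_decode (polynomial_value K (e + m) (encode_laurent f))) =
      real_of_int (int (K ^ e) * row_entry j (candidate_row i K c))"
    by (simp only: of_int_eq_iff)
  also have "\<dots> \<longleftrightarrow> real K ^ (e + m) * laurent_eval (real K) f = real K ^ e * laurent_eval (real K) g"
    using row unfolding val row_represents_def by (simp add: g_def)
  also have "\<dots> \<longleftrightarrow> laurent_eval (real K) f = laurent_eval (real K) (g * Poly_Mapping.single (- int m) 1)"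
    using K by (simp add: laurent_eval_times_single power_add power_int_minus field_simps)
  also have "\<dots> \<longleftrightarrow> f = g * Poly_Mapping.single (- int m) 1"
  proof
    assume eq: "laurent_eval (real K) f = laurent_eval (real K) (g * Poly_Mapping.single (- int m) 1)"
    show "f = g * Poly_Mapping.single (- int m) 1"
    proof (rule laurent_eval_inj[OF _ _ _ eq])
      show "\<bar>Poly_Mapping.lookup f n\<bar> \<le> int e" for n
        using encode_laurent_bounds(2)[of n f] f_le by (cases "n \<in> Poly_Mapping.keys f") (auto simp: in_keys_iff)
      \<comment> \<open>Both components of the code are at most \<open>c\<close>: there are at most
        3 c factors \<open>Delta\<close> and at most c others, whence the exponent 4 c.\<close>
      have "int_encode p \<le> c" "list_encode (map simple_code ss) \<le> c"
        unfolding c_def candidate_code_def by (rule le_prod_encode_1, rule le_prod_encode_2)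
      then have "length W \<le> 4 * c"
        using abs_le_int_encode[of p] length_le_list_encode[of "map simple_code ss"]
        by (simp add: W_def delta_count_def)
      then have le: "(6 :: int) ^ length W \<le> 6 ^ (4 * c)" by (rule power_increasing) simp
      show "\<bar>Poly_Mapping.lookup (g * Poly_Mapping.single (- int m) 1) n\<bar> \<le> int (6 ^ (4 * c))" for n
        using order_trans[OF coefficient_bound[of W i j "n + int m"] le] by (simp add: lookup_times_single g_def)
      show "e + 6 ^ (4 * c) < K" by (simp add: K_def)
    qed
  qed simp
  finally show ?thesis unfolding entry f_def c_def e_def .
qed

lemma candidate_test_iff:
  "candidate_test (prod_encode (c, encode_matrix A)) \<longleftrightarrow>
    (\<exists>p ss. c = candidate_code p ss \<and> good_sequence ss \<and> Delta \<notin> set ss \<and>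
      A = burau (delta powi p * simples_braid ss))"
proof
  assume test: "candidate_test (prod_encode (c, encode_matrix A))"
  then obtain ss where ss: "list_decode (psnd c) = map simple_code ss" "good_sequence ss" "Delta \<notin> set ss"
    by (auto simp: candidate_test_def foldl_sequence_step_neq_1 simp del: One_nat_def)
  define p where "p = int_decode (pfst c)"
  have c: "c = candidate_code p ss"
    unfolding candidate_code_def p_def by (simp add: prod_encode_pfst_psnd flip: ss(1))
  then have "\<forall>i j. A $ i $ j = burau (delta powi p * simples_braid ss) $ i $ j"
    using test by (simp add: candidate_test_def entry_test_iff)
  then have "A = burau (delta powi p * simples_braid ss)" by (simp add: vec_eq_iff)
  with c ss show "\<exists>p ss. c = candidate_code p ss \<and> good_sequence ss \<and> Delta \<notin> set ss \<and>
      A = burau (delta powi p * simples_braid ss)" by blast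
next
  assume "\<exists>p ss. c = candidate_code p ss \<and> good_sequence ss \<and> Delta \<notin> set ss \<and>
      A = burau (delta powi p * simples_braid ss)"
  then obtain p ss where *: "c = candidate_code p ss" "good_sequence ss" "Delta \<notin> set ss"
    "A = burau (delta powi p * simples_braid ss)" by blast
  have "foldl sequence_step 0 (map simple_code ss) \<noteq> 1"
    unfolding foldl_sequence_step_neq_1 using *(2,3) by blast
  then have "foldl sequence_step 0 (list_decode (psnd c)) \<noteq> 1"
    by (simp add: *(1) candidate_code_def)
  then show "candidate_test (prod_encode (c, encode_matrix A))"
    unfolding candidate_test_def *(1) entry_test_iff by (simp add: *(4))
qed

section \<open>Correctness of the search and the main statement\<close>

lemma represents_candidate_code:
  "represents_normal_form (candidate_code p ss) p (map simple_braid ss)"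
  unfolding represents_normal_form_def
proof (intro exI[of _ "map simple_word ss"] conjI)
  have "is_band_word (simple_word s)" for s
    by (cases s) (simp_all add: is_band_word_def)
  then show "\<forall>w\<in>set (map simple_word ss). is_band_word w" by simp
  show "map eval_band_word (map simple_word ss) = map simple_braid ss"
    by (simp add: simple_braid_def)
  show "candidate_code p ss = encode_normal_form p (map simple_word ss)"
    by (simp add: candidate_code_def encode_normal_form_def simple_code_def[abs_def] comp_def)
qed

theorem normal_form_algorithm:
  "\<exists>alg. \<forall>x p ds. dual_normal_form x p ds \<and> avoids_forbidden ds \<longrightarrow>
    (\<exists>out. computes alg [encode_matrix (burau x)] out \<and> represents_normal_form out p ds)"
proof -
  obtain alg where alg: "\<And>e. \<exists>c. candidate_test (prod_encode (c, e)) \<Longrightarrow>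
      computes alg [e] (LEAST c. candidate_test (prod_encode (c, e)))"
    using recursive_search[OF recursive_pred_candidate_test] by blast
  have "\<exists>out. computes alg [encode_matrix (burau x)] out \<and> represents_normal_form out p ds"
    if nf: "dual_normal_form x p ds" "avoids_forbidden ds" for x p ds
  proof -
    let ?T = "\<lambda>c. candidate_test (prod_encode (c, encode_matrix (burau x)))"
    obtain ss where ss: "ds = map simple_braid ss" "good_sequence ss" "Delta \<notin> set ss"
      by (rule dual_normal_form_good_sequence[OF nf])
    have x: "x = delta powi p * simples_braid ss"
      using nf(1) by (simp add: dual_normal_form_def simples_braid_def ss(1))
    \<comment> \<open>The assumption on \<open>x\<close> enters here: its own normal form is a
      candidate that passes, so the search halts.\<close>
    have ex: "\<exists>c. ?T c" unfolding candidate_test_iff x using ss(2,3) by blast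
    then have "?T (LEAST c. ?T c)" by (rule LeastI_ex)
    then obtain r ts where ts: "(LEAST c. ?T c) = candidate_code r ts" "good_sequence ts" "Delta \<notin> set ts"
      "burau x = burau (delta powi r * simples_braid ts)"
      unfolding candidate_test_iff by blast
    \<comment> \<open>The least passing candidate need not come from \<open>x\<close> a priori;
      equality of the matrices forces it to.\<close>
    have "p = r \<and> ss = ts"
      using normal_form_unique[OF ss(2) ts(2) ss(3) ts(3)] ts(4) x by simp
    then have "represents_normal_form (LEAST c. ?T c) p ds"
      unfolding ts(1) ss(1) using represents_candidate_code by simp
    then show ?thesis using alg[OF ex] by blast
  qed
  then show ?thesis by blast
qed

theorem corollary6p12:
  shows "(\<forall>x p ds. dual_normal_form x p ds \<and> avoids_forbidden ds \<longrightarrow>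
            Fin (dual_sup p ds) = mat_max_deg (burau x)) \<and>
         (\<exists>alg. \<forall>x p ds. dual_normal_form x p ds \<and> avoids_forbidden ds \<longrightarrow>
            (\<exists>out. computes alg [encode_matrix (burau x)] out \<and>
                   represents_normal_form out p ds)) \<and>
         (\<forall>x p ds. dual_normal_form x p ds \<and> x \<noteq> 1 \<and>
            (\<forall>d\<in>set ds. d \<noteq> band 1 2 * band 3 4 \<and> d \<noteq> band 2 3 * band 1 4) \<longrightarrow>
            burau x \<noteq> mat 1)"
proof (intro conjI normal_form_algorithm allI impI; elim conjE)
  fix x p ds assume nf: "dual_normal_form x p ds" "avoids_forbidden ds"
  obtain ss where ss: "ds = map simple_braid ss" "good_sequence ss" "Delta \<notin> set ss"
    by (rule dual_normal_form_good_sequence[OF nf])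
  have "x = delta powi p * simples_braid ss"
    using nf(1) by (simp add: dual_normal_form_def simples_braid_def ss(1))
  then show "Fin (dual_sup p ds) = mat_max_deg (burau x)"
    using normal_form_degree[OF ss(2)] by (simp add: dual_sup_def ss(1))
next
  fix x p ds assume nf: "dual_normal_form x p ds" and "x \<noteq> 1"
    and "\<forall>d\<in>set ds. d \<noteq> band 1 2 * band 3 4 \<and> d \<noteq> band 2 3 * band 1 4"
  then have "avoids_forbidden ds"
    unfolding avoids_forbidden_def forbidden_pairs_def by (auto dest: nth_mem[OF Suc_lessD])
  then obtain ss where ss: "ds = map simple_braid ss" "good_sequence ss" "Delta \<notin> set ss"
    by (rule dual_normal_form_good_sequence[OF nf])
  have x: "x = delta powi p * simples_braid ss"
    using nf(1) by (simp add: dual_normal_form_def simples_braid_def ss(1))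
  show "burau x \<noteq> mat 1"
  proof
    assume "burau x = mat 1"
    \<comment> \<open>The identity matrix belongs to the empty sequence with exponent 0, to which
      uniqueness is applied.\<close>
    then have "burau (delta powi p * simples_braid ss) = burau (delta powi 0 * simples_braid [])"
      by (simp add: x simples_braid_def burau_one)
    then have "p = 0 \<and> ss = []"
      by (intro normal_form_unique[OF ss(2) _ ss(3)]) simp_all
    then show False using \<open>x \<noteq> 1\<close> x by (simp add: simples_braid_def)
  qed
qed

end
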